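(* Let $X \neq \{0\}$ be a complex Banach space with norm $\|\cdot\|$ and open unit ball $\mathbb{B}=\{z\in X:\|z\|<1\}$. Let $f:\mathbb{B}\to\mathbb{C}$ be holomorphic with $f(0)=1$, and suppose that the mapping $F:\mathbb{B}\to X$, $F(z)=z f(z)=f(z)\,z$, belongs to $\mathcal{S}^*(\mathbb{B})$. Then for every $z\in X\setminus\{0\}$ and every $l_z\in T_z$, $$\left| \left(\frac{l_z\big(D^3F(0)(z^3)\big)}{3!\,\|z\|^3}\right)^2-\frac{l_z\big(D^5F(0)(z^5)\big)}{5!\,\|z\|^5}\right|\le 4 .$$ The bound is sharp: for every such $X$ there exist a holomorphic $f:\mathbb{B}\to\mathbb{C}$ with $f(0)=1$ and $F(z)=zf(z)\in\mathcal{S}^*(\mathbb{B})$, a point $z\in X\setminus\{0\}$ and $l_z\in T_z$ for which equality holds.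
   Context: For $z\in X\setminus\{0\}$, $T_z=\{l_z\in L(X,\mathbb{C}): l_z(z)=\|z\|,\ \|l_z\|=1\}$, where $L(X,Y)$ denotes the space of continuous linear operators from $X$ to a complex Banach space $Y$; $T_z$ is non-empty by the Hahn-Banach theorem. For a holomorphic mapping $F:\mathbb{B}\to X$, $D^mF(0)$ denotes the $m$-th Fréchet derivative of $F$ at $0$, a bounded symmetric $m$-linear mapping $X^m\to X$, and $D^mF(0)(z^m)=D^mF(0)(z,\dots,z)$ ($m$ copies of $z$). A holomorphic mapping $F:\mathbb{B}\to X$ is normalized if $F(0)=0$ and $DF(0)=I$ (the identity operator on $X$), and locally biholomorphic if $DF(z)$ has a bounded inverse for each $z\in\mathbb{B}$. The class $\mathcal{S}^*(\mathbb{B})$ of starlike mappings on $\mathbb{B}$ consists of all normalized locally biholomorphic mappings $F:\mathbb{B}\to X$ such that $\operatorname{Re}\big(l_z([DF(z)]^{-1}F(z))\big)>0$ for all $z\in\mathbb{B}\setminus\{0\}$ and all $l_z\in T_z$. *)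

theory Defs
  imports "HOL-Analysis.Analysis"
begin

class complex_normed_vector = real_normed_vector +
  fixes scaleC :: "complex \<Rightarrow> 'a \<Rightarrow> 'a"  (infixr "*\<^sub>C" 75)
  assumes scaleC_add_right: "c *\<^sub>C (x + y) = c *\<^sub>C x + c *\<^sub>C y"
    and scaleC_add_left: "(c + d) *\<^sub>C x = c *\<^sub>C x + d *\<^sub>C x"
    and scaleC_scaleC: "c *\<^sub>C d *\<^sub>C x = (c * d) *\<^sub>C x"
    and scaleC_of_real: "complex_of_real r *\<^sub>C x = r *\<^sub>R x"
    and norm_scaleC: "norm (c *\<^sub>C x) = cmod c * norm x"

class complex_banach = complex_normed_vector + banach

instantiation complex :: complex_banach
begin

definition scaleC_complex :: "complex \<Rightarrow> complex \<Rightarrow> complex"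
  where "scaleC_complex c x = c * x"

instance
  by standard
    (simp_all add: scaleC_complex_def algebra_simps norm_mult scaleR_conv_of_real)

end

definition bounded_clinear ::
    "('a::complex_normed_vector \<Rightarrow> 'b::complex_normed_vector) \<Rightarrow> bool"
  where "bounded_clinear A \<longleftrightarrow> bounded_linear A \<and> (\<forall>c x. A (c *\<^sub>C x) = c *\<^sub>C A x)"

(* Complex Frechet differentiability.  The library's has_derivative only asks for a
   real-linear derivative, so complex linearity is required separately. *)
definition frechet_holomorphic_on ::
    "('a::complex_normed_vector \<Rightarrow> 'b::complex_normed_vector) \<Rightarrow> 'a set \<Rightarrow> bool"
    (infixl "frechet'_holomorphic'_on" 50)
  where "f frechet_holomorphic_on S \<longleftrightarrow>
    (\<forall>z\<in>S. \<exists>A. bounded_clinear A \<and> (f has_derivative A) (at z within S))"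

(* The Frechet derivative as a map into the space of bounded operators with the operator
   norm, so that it can be iterated: fderiv (fderiv F) takes values in 'a => L('a, L('a, 'b)),
   which is the space of bounded bilinear maps, and so on.  The operators here are
   real-linear; where the function is holomorphic, its derivative is complex-linear, and the
   norm is the same. *)
definition fderiv :: "('a::real_normed_vector \<Rightarrow> 'b::real_normed_vector) \<Rightarrow> 'a \<Rightarrow> 'a \<Rightarrow>\<^sub>L 'b"
  where "fderiv F z = Blinfun (frechet_derivative F (at z))"

definition D3 :: "('a::real_normed_vector \<Rightarrow> 'b::real_normed_vector) \<Rightarrow> 'a \<Rightarrow> 'a \<Rightarrow> 'a \<Rightarrow> 'a \<Rightarrow> 'b"
  where "D3 F a u v w = fderiv (fderiv (fderiv F)) a u v w"

definition D5 :: "('a::real_normed_vector \<Rightarrow> 'b::real_normed_vector) \<Rightarrow>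
    'a \<Rightarrow> 'a \<Rightarrow> 'a \<Rightarrow> 'a \<Rightarrow> 'a \<Rightarrow> 'a \<Rightarrow> 'b"
  where "D5 F a u v w x y = fderiv (fderiv (fderiv (fderiv (fderiv F)))) a u v w x y"

definition support_functionals :: "'a::complex_normed_vector \<Rightarrow> ('a \<Rightarrow> complex) set"
  where "support_functionals z =
    {l. bounded_clinear l \<and> l z = complex_of_real (norm z) \<and> onorm l = 1}"

definition normalized :: "('a::complex_normed_vector \<Rightarrow> 'a) \<Rightarrow> bool"
  where "normalized F \<longleftrightarrow> F 0 = 0 \<and> fderiv F 0 = id_blinfun"

definition locally_biholomorphic_on ::
    "('a::complex_normed_vector \<Rightarrow> 'a) \<Rightarrow> 'a set \<Rightarrow> bool"
    (infixl "locally'_biholomorphic'_on" 50)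
  where "F locally_biholomorphic_on S \<longleftrightarrow> F frechet_holomorphic_on S \<and>
    (\<forall>z\<in>S. bij (blinfun_apply (fderiv F z)) \<and> bounded_clinear (inv (blinfun_apply (fderiv F z))))"

(* Mappings on the open unit ball are represented by total functions; only their values on the
   ball matter. *)
definition starlike_mappings :: "('a::complex_normed_vector \<Rightarrow> 'a) set"
  where "starlike_mappings = {F. F locally_biholomorphic_on (ball 0 1) \<and> normalized F \<and>
    (\<forall>z \<in> ball 0 1 - {0}. \<forall>l \<in> support_functionals z.
       Re (l (inv (blinfun_apply (fderiv F z)) (F z))) > 0)}"

end

theory Submission
  imports Defs "HOL-Complex_Analysis.Complex_Analysis"
begin

text \<open>Fix a unit vector \<open>u\<close> with a support functional \<open>l\<close>, and put \<open>g(\<zeta>) = f(\<zeta> u)\<close> on the unit disc. Then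
  \<open>l(F(\<zeta> u)) = \<zeta> g(\<zeta>)\<close>, and the two normalized derivatives in the theorem are the coefficients \<open>a\<^sub>3\<close>
  and \<open>a\<^sub>5\<close> of this function. Because \<open>F(z)\<close> is a multiple of \<open>z\<close>, the starlikeness condition on \<open>F\<close>
  along the line through \<open>u\<close> says exactly that \<open>\<zeta> g(\<zeta>)\<close> is a starlike function of one variable. The
  claim is therefore the Zalcman inequality \<open>\<bar>a\<^sub>3\<^sup>2 - a\<^sub>5\<bar> \<le> 4\<close> for starlike functions, with equality for
  the Koebe function \<open>\<zeta> / (1 - \<zeta>)\<^sup>2\<close>. In \<open>X\<close>, equality is attained by \<open>z / (1 - l z)\<^sup>2\<close>
  (\<open>koebe_mapping\<close>).

  In one variable, \<open>p = 1 + \<zeta> g' / g\<close> has positive real part and value \<open>1\<close> at the origin, and half its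
  coefficients are, up to a dilation, the moments \<open>c\<^sub>1, c\<^sub>2, c\<^sub>3, c\<^sub>4\<close> of a probability measure on the
  unit circle. In these terms \<open>a\<^sub>3\<^sup>2 - a\<^sub>5\<close> equals
  \<open>10/3 c\<^sub>1\<^sup>4 + 2 c\<^sub>1\<^sup>2 c\<^sub>2 + c\<^sub>2\<^sup>2 / 2 - c\<^sub>4 / 2 - 4/3 c\<^sub>1 c\<^sub>3\<close>. Writing it through the variances and
  covariances of the first two powers of a random point, weighted arithmetic-geometric means bound
  it by \<open>5/3 + 2 \<bar>c\<^sub>1\<bar>\<^sup>2 + \<bar>c\<^sub>1\<bar>\<^sup>4 / 3 \<le> 4\<close> (\<open>zalcman_moment_bound\<close>).

  The derivatives of \<open>F\<close> are iterated Frechet derivatives with values in spaces of operators. That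
  they agree with the derivatives of the slices requires that the derivative of a holomorphic map is
  again holomorphic in operator norm (\<open>frechet_holomorphic_on_fderiv\<close>). This rests on Cauchy
  estimates, which carry over from scalar functions by norming functionals
  (\<open>norming_functional_exists\<close>); the latter also provide the functional \<open>l\<close> of the extremal mapping.\<close>

section \<open>Complex scalars on spaces of operators\<close>

lemma scaleC_one [simp]: "1 *\<^sub>C (x::'a::complex_normed_vector) = x"
  using scaleC_of_real[of 1 x] by simp

lemma bounded_bilinear_scaleC:
  "bounded_bilinear (\<lambda>c (x::'a::complex_normed_vector). c *\<^sub>C x)"
proof
  show "(r *\<^sub>R c) *\<^sub>C x = r *\<^sub>R c *\<^sub>C x" for r c and x :: 'a
    by (simp add: scaleR_conv_of_real flip: scaleC_scaleC scaleC_of_real)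
  show "c *\<^sub>C r *\<^sub>R x = r *\<^sub>R c *\<^sub>C x" for r c and x :: 'a
    by (metis scaleC_scaleC scaleC_of_real mult.commute)
  show "\<exists>K. \<forall>c (x::'a). norm (c *\<^sub>C x) \<le> norm c * norm x * K"
    by (rule exI[of _ 1]) (simp add: norm_scaleC)
qed (simp_all add: scaleC_add_left scaleC_add_right)

interpretation scaleC: bounded_bilinear "(*\<^sub>C) :: complex \<Rightarrow> 'a \<Rightarrow> 'a::complex_normed_vector"
  by (rule bounded_bilinear_scaleC)

declare scaleC.zero_left [simp] scaleC.zero_right [simp]

lemma bounded_clinearI:
  assumes "bounded_linear A" "\<And>c x. A (c *\<^sub>C x) = c *\<^sub>C A x"
  shows "bounded_clinear A"
  using assms by (simp add: bounded_clinear_def)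

lemma bounded_clinear_functional_scaleC:
  assumes "bounded_clinear (l :: 'a::complex_normed_vector \<Rightarrow> complex)"
  shows "l (c *\<^sub>C x) = c * l x"
  using assms by (simp add: bounded_clinear_def scaleC_complex_def)

text \<open>The derivative of a holomorphic map takes values in a space of bounded operators. To say that
  this derivative is again holomorphic, the operators need a complex structure: a complex scalar
  acts on the values of an operator. With it, one theorem about a single derivative can be iterated.\<close>

instantiation blinfun :: (real_normed_vector, complex_normed_vector) complex_normed_vector
begin

lift_definition scaleC_blinfun :: "complex \<Rightarrow> ('a \<Rightarrow>\<^sub>L 'b) \<Rightarrow> 'a \<Rightarrow>\<^sub>L 'b"
  is "\<lambda>c A x. c *\<^sub>C A x"
  by (rule bounded_linear_compose[OF scaleC.bounded_linear_right])

instance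
proof
  fix c d :: complex and r :: real and A B :: "'a \<Rightarrow>\<^sub>L 'b"
  show "c *\<^sub>C (A + B) = c *\<^sub>C A + c *\<^sub>C B"
    by transfer (simp add: scaleC_add_right)
  show "(c + d) *\<^sub>C A = c *\<^sub>C A + d *\<^sub>C A"
    by transfer (simp add: scaleC_add_left)
  show "c *\<^sub>C d *\<^sub>C A = (c * d) *\<^sub>C A"
    by transfer (simp add: scaleC_scaleC)
  show "complex_of_real r *\<^sub>C A = r *\<^sub>R A"
    by transfer (simp add: scaleC_of_real)
  have "norm (c *\<^sub>C A) = onorm (\<lambda>x. c *\<^sub>C blinfun_apply A x)"
    by transfer simp
  also have "\<dots> = onorm (\<lambda>x. cmod c *\<^sub>R blinfun_apply A x)"
    by (simp add: onorm_def norm_scaleC)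
  also have "\<dots> = cmod c * norm A"
    by (subst onorm_scaleR) (simp_all add: blinfun.bounded_linear_right norm_blinfun.rep_eq)
  finally show "norm (c *\<^sub>C A) = cmod c * norm A" .
qed

end

instance blinfun :: (real_normed_vector, complex_banach) complex_banach ..

lemma blinfun_apply_scaleC [simp]: "blinfun_apply (c *\<^sub>C A) x = c *\<^sub>C blinfun_apply A x"
  by transfer simp

section \<open>Norming functionals\<close>

text \<open>The Hahn-Banach theorem is obtained here from minimal sublinear functionals: Zorn's lemma
  provides a minimal one below any given sublinear functional, and minimality forces linearity.\<close>

definition sublinear :: "('a::real_vector \<Rightarrow> real) \<Rightarrow> bool"
  where "sublinear q \<longleftrightarrow>
    (\<forall>x y. q (x + y) \<le> q x + q y) \<and> (\<forall>t\<ge>0. \<forall>x. q (t *\<^sub>R x) = t * q x)"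

lemma sublinearD:
  assumes "sublinear q"
  shows "q (x + y) \<le> q x + q y" and "t \<ge> 0 \<Longrightarrow> q (t *\<^sub>R x) = t * q x"
    and "q 0 = 0" and "- q (- x) \<le> q x"
proof -
  show add: "q (x + y) \<le> q x + q y" for x y
    using assms by (simp add: sublinear_def)
  show hom: "t \<ge> 0 \<Longrightarrow> q (t *\<^sub>R x) = t * q x" for t x
    using assms by (simp add: sublinear_def)
  show z: "q 0 = 0"
    using hom[of 0 0] by simp
  show "- q (- x) \<le> q x"
    using add[of x "- x"] z by simp
qed

text \<open>The functional \<open>tilt q a\<close> is the largest sublinear functional below \<open>q\<close> whose value at
  \<open>- a\<close> is at most \<open>- q a\<close>. It serves twice: applied to a minimal \<open>q\<close> it shows that \<open>q\<close> is
  additive, and applied to the norm it makes every linear functional below it attain the norm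
  of \<open>a\<close>.\<close>

definition tilt :: "('a::real_vector \<Rightarrow> real) \<Rightarrow> 'a \<Rightarrow> 'a \<Rightarrow> real"
  where "tilt q a y = (INF t\<in>{0..}. q (y + t *\<^sub>R a) - t * q a)"

lemma tilt_le:
  assumes q: "sublinear q" and t: "t \<ge> 0"
  shows "tilt q a y \<le> q (y + t *\<^sub>R a) - t * q a"
proof -
  have "- q (- y) \<le> q (y + s *\<^sub>R a) - s * q a" if "s \<ge> 0" for s
    using sublinearD(1)[OF q, of "y + s *\<^sub>R a" "- y"] sublinearD(2)[OF q that, of a] by simp
  then have "bdd_below ((\<lambda>t. q (y + t *\<^sub>R a) - t * q a) ` {0..})"
    by (intro bdd_belowI2) auto
  then show ?thesis
    unfolding tilt_def using t by (intro cINF_lower) auto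
qed

lemma tilt_greatest:
  assumes "\<And>t. t \<ge> 0 \<Longrightarrow> c \<le> q (y + t *\<^sub>R a) - t * q a"
  shows "c \<le> tilt q a y"
  unfolding tilt_def using assms by (intro cINF_greatest) auto

lemma sublinear_tilt:
  assumes q: "sublinear q"
  shows "sublinear (tilt q a)"
  unfolding sublinear_def
proof (intro conjI allI impI)
  fix x y
  have "tilt q a (x + y) - (q (y + t *\<^sub>R a) - t * q a) \<le> tilt q a x" if t: "t \<ge> 0" for t
  proof (rule tilt_greatest)
    fix s :: real assume s: "s \<ge> 0"
    have "tilt q a (x + y) \<le> q (x + y + (s + t) *\<^sub>R a) - (s + t) * q a"
      using tilt_le[OF q, of "s + t"] s t by simp
    also have "x + y + (s + t) *\<^sub>R a = (x + s *\<^sub>R a) + (y + t *\<^sub>R a)"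
      by (simp add: algebra_simps)
    also have "q \<dots> \<le> q (x + s *\<^sub>R a) + q (y + t *\<^sub>R a)"
      by (rule sublinearD(1)[OF q])
    finally show "tilt q a (x + y) - (q (y + t *\<^sub>R a) - t * q a) \<le> q (x + s *\<^sub>R a) - s * q a"
      by (simp add: algebra_simps)
  qed
  then have "tilt q a (x + y) - tilt q a x \<le> tilt q a y"
    by (intro tilt_greatest) (simp add: algebra_simps)
  then show "tilt q a (x + y) \<le> tilt q a x + tilt q a y"
    by simp
next
  fix r :: real and x assume r: "r \<ge> 0"
  have scale: "r * tilt q a x \<le> tilt q a (r *\<^sub>R x)" if r: "r > 0" for r x
  proof (rule tilt_greatest)
    fix t :: real assume t: "t \<ge> 0"
    have "r * tilt q a x \<le> r * (q (x + (t / r) *\<^sub>R a) - t / r * q a)"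
      using tilt_le[OF q, of "t / r"] r t by (intro mult_left_mono) auto
    also have "\<dots> = q (r *\<^sub>R (x + (t / r) *\<^sub>R a)) - t * q a"
      using r sublinearD(2)[OF q, of r "x + (t / r) *\<^sub>R a"] by (simp add: right_diff_distrib)
    also have "r *\<^sub>R (x + (t / r) *\<^sub>R a) = r *\<^sub>R x + t *\<^sub>R a"
      using r by (simp add: algebra_simps)
    finally show "r * tilt q a x \<le> q (r *\<^sub>R x + t *\<^sub>R a) - t * q a" .
  qed
  show "tilt q a (r *\<^sub>R x) = r * tilt q a x"
  proof (cases "r = 0")
    case True
    have "tilt q a 0 = 0"
    proof (rule antisym)
      show "tilt q a 0 \<le> 0"
        using tilt_le[OF q, of 0 a 0] sublinearD(3)[OF q] by simp
      show "0 \<le> tilt q a 0"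
        by (rule tilt_greatest) (simp add: sublinearD(2)[OF q])
    qed
    then show ?thesis using True by simp
  next
    case False
    with r have r: "r > 0" by simp
    have "inverse r * tilt q a (r *\<^sub>R x) \<le> tilt q a x"
      using scale[of "inverse r" "r *\<^sub>R x"] r by simp
    then have "tilt q a (r *\<^sub>R x) \<le> r * tilt q a x"
      using r by (simp add: field_simps)
    then show ?thesis using scale[OF r, of x] by simp
  qed
qed

text \<open>A minimal functional equals its own tilt towards \<open>x\<close>, and the parameter value \<open>1\<close> in the
  infimum then gives superadditivity.\<close>

lemma minimal_sublinear_additive:
  assumes q: "sublinear q" and min: "\<And>q'. sublinear q' \<Longrightarrow> q' \<le> q \<Longrightarrow> q' = q"
  shows "q (x + y) = q x + q y"
proof (rule antisym)
  have "tilt q x \<le> q"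
    using tilt_le[OF q, of 0] by (auto simp: le_fun_def)
  then have "tilt q x = q"
    by (intro min sublinear_tilt q)
  then show "q x + q y \<le> q (x + y)"
    using tilt_le[OF q, of 1 x y] by (simp add: add.commute)
qed (rule sublinearD(1)[OF q])

text \<open>The lower bound that Zorn's lemma asks for. Two members of a chain can be replaced by the
  smaller one, which is why subadditivity passes to the infimum.\<close>

lemma sublinear_INF_chain:
  fixes C :: "('a::real_vector \<Rightarrow> real) set"
  assumes ne: "C \<noteq> {}" and sub: "\<And>q. q \<in> C \<Longrightarrow> sublinear q"
    and chain: "\<And>q r. q \<in> C \<Longrightarrow> r \<in> C \<Longrightarrow> q \<le> r \<or> r \<le> q"
    and bdd: "\<And>q. q \<in> C \<Longrightarrow> q \<le> b"
  defines "i \<equiv> \<lambda>x. INF q\<in>C. q x"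
  shows "sublinear i" and "\<And>q. q \<in> C \<Longrightarrow> i \<le> q"
proof -
  have "- b (- x) \<le> q x" if "q \<in> C" for q x
    using sublinearD(4)[OF sub[OF that], of x] bdd[OF that] by (smt (verit) le_funD)
  then have bb: "bdd_below ((\<lambda>q. q x) ` C)" for x
    by (intro bdd_belowI2)
  have le: "i x \<le> q x" if "q \<in> C" for q x
    unfolding i_def using bb that by (intro cINF_lower)
  then show "\<And>q. q \<in> C \<Longrightarrow> i \<le> q"
    by (simp add: le_fun_def)
  have greatest: "c \<le> i x" if "\<And>q. q \<in> C \<Longrightarrow> c \<le> q x" for c x
    unfolding i_def using that ne by (intro cINF_greatest)
  show "sublinear i"
    unfolding sublinear_def
  proof (intro conjI allI impI)
    fix x y
    have *: "i (x + y) \<le> q x + r y" if qr: "q \<in> C" "r \<in> C" for q r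
    proof -
      obtain s where s: "s \<in> C" "s \<le> q" "s \<le> r"
        using chain[OF qr] qr by auto
      have "i (x + y) \<le> s x + s y"
        using le[OF s(1)] sublinearD(1)[OF sub[OF s(1)]] by (rule order_trans)
      also have "\<dots> \<le> q x + r y"
        using s by (intro add_mono) (auto simp: le_fun_def)
      finally show ?thesis .
    qed
    have "i (x + y) - r y \<le> i x" if "r \<in> C" for r
      using * that by (intro greatest) (simp add: algebra_simps)
    then have "i (x + y) - i x \<le> i y"
      by (intro greatest) (simp add: algebra_simps)
    then show "i (x + y) \<le> i x + i y"
      by simp
  next
    fix t :: real and x assume t: "t \<ge> 0"
    have "t * i x \<le> i (t *\<^sub>R x)"
      using le t sub by (intro greatest) (simp add: sublinearD(2) mult_left_mono)
    moreover have "i (t *\<^sub>R x) \<le> t * i x"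
    proof (cases "t = 0")
      case True
      obtain q where "q \<in> C" using ne by auto
      then show ?thesis using le[of q 0] sublinearD(3)[OF sub, of q] True by simp
    next
      case False
      then have "inverse t * i (t *\<^sub>R x) \<le> i x"
        using le[of _ "t *\<^sub>R x"] t sub by (intro greatest) (simp add: sublinearD(2) field_simps)
      then show ?thesis using False t by (simp add: field_simps)
    qed
    ultimately show "i (t *\<^sub>R x) = t * i x" by simp
  qed
qed

lemma linear_below_sublinear:
  fixes b :: "'a::real_vector \<Rightarrow> real"
  assumes b: "sublinear b"
  obtains r where "linear r" "r \<le> b"
proof -
  define A where "A = {q. sublinear q \<and> q \<le> b}"
  have "\<exists>m\<in>A. \<forall>a\<in>A. a \<le> m \<longrightarrow> a = m"
  proof (rule predicate_Zorn)
    show "partial_order_on A (relation_of (\<lambda>x y. y \<le> x) A)"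
      by (auto simp: partial_order_on_def preorder_on_def refl_on_def trans_def antisym_def
          relation_of_def)
    fix C assume C: "C \<in> Chains (relation_of (\<lambda>x y. y \<le> x) A)"
    then have CA: "C \<subseteq> A" and chain: "\<And>q r. q \<in> C \<Longrightarrow> r \<in> C \<Longrightarrow> q \<le> r \<or> r \<le> q"
      by (auto simp: Chains_def relation_of_def)
    show "\<exists>u\<in>A. \<forall>a\<in>C. u \<le> a"
    proof (cases "C = {}")
      case True
      then show ?thesis using b by (auto simp: A_def)
    next
      case False
      note i = sublinear_INF_chain[OF False _ chain, of b]
      have "(\<lambda>x. INF q\<in>C. q x) \<in> A"
        using i CA False unfolding A_def by (blast intro: order_trans)
      moreover have "\<forall>a\<in>C. (\<lambda>x. INF q\<in>C. q x) \<le> a"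
        using i(2) CA unfolding A_def by blast
      ultimately show ?thesis by blast
    qed
  qed
  then obtain r where r: "sublinear r" "r \<le> b"
    and min: "\<And>q. sublinear q \<Longrightarrow> q \<le> b \<Longrightarrow> q \<le> r \<Longrightarrow> q = r"
    unfolding A_def by blast
  have add: "r (x + y) = r x + r y" for x y
    using r min by (intro minimal_sublinear_additive) (auto intro: order_trans)
  have neg: "r (- x) = - r x" for x
    using add[of x "- x"] sublinearD(3)[OF r(1)] by simp
  have "r (t *\<^sub>R x) = t * r x" for t x
    using sublinearD(2)[OF r(1), of "\<bar>t\<bar>" x] neg[of "t *\<^sub>R x"] by (cases "t \<ge> 0") auto
  then have "linear r"
    by (intro linearI) (simp_all add: add)
  with r(2) show ?thesis using that by blast
qed

lemma real_support_functional:
  fixes x :: "'a::real_normed_vector"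
  obtains r :: "'a \<Rightarrow> real" where "linear r" "r x = norm x" "\<And>y. \<bar>r y\<bar> \<le> norm y"
proof -
  have n: "sublinear (norm :: 'a \<Rightarrow> real)"
    by (auto simp: sublinear_def norm_triangle_ineq)
  obtain r where lin: "linear r" and le: "r \<le> tilt norm x"
    using linear_below_sublinear[OF sublinear_tilt[OF n]] by blast
  have tn: "tilt norm x y \<le> norm (y + t *\<^sub>R x) - t * norm x" if "t \<ge> 0" for t y
    by (rule tilt_le[OF n that])
  have bound: "r y \<le> norm y" for y
    using le_funD[OF le, of y] tn[of 0 y] by simp
  have "r (- x) \<le> - norm x"
    using le_funD[OF le, of "- x"] tn[of 1 "- x"] by simp
  then have "r x = norm x"
    using bound[of x] by (simp add: linear_neg[OF lin])
  moreover have "\<bar>r y\<bar> \<le> norm y" for y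
    using bound[of y] bound[of "- y"] by (simp add: linear_neg[OF lin])
  ultimately show ?thesis using that lin by blast
qed

text \<open>A complex-linear functional is determined by its real part \<open>r\<close> as \<open>r y - \<i> r (\<i> y)\<close>. A rotation
  that makes the value at \<open>y\<close> real transfers the bound from \<open>r\<close> to the complex functional.\<close>

lemma norming_functional_exists:
  fixes x :: "'a::complex_normed_vector"
  obtains l where "bounded_clinear l" "l x = of_real (norm x)" "\<And>y. cmod (l y) \<le> norm y"
proof -
  obtain r :: "'a \<Rightarrow> real" where lin: "linear r" and rx: "r x = norm x"
    and le: "\<And>y. \<bar>r y\<bar> \<le> norm y"
    using real_support_functional[of x] by blast
  define l where "l y = Complex (r y) (- r (\<i> *\<^sub>C y))" for y
  have real: "l (s *\<^sub>R y) = of_real s * l y" for s y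
    by (simp add: l_def complex_eq_iff linear_scale[OF lin] scaleC.scaleR_right)
  have add: "l (y + w) = l y + l w" for y w
    by (simp add: l_def complex_eq_iff linear_add[OF lin] scaleC.add_right)
  have i: "l (\<i> *\<^sub>C y) = \<i> * l y" for y
    using linear_neg[OF lin, of y]
    by (simp add: l_def complex_eq_iff scaleC_scaleC scaleC.minus_left)
  have scale: "l (c *\<^sub>C y) = c * l y" for c y
  proof -
    have "c *\<^sub>C y = Re c *\<^sub>R y + Im c *\<^sub>R \<i> *\<^sub>C y"
      by (subst (1) complex_eq[of c])
        (simp add: scaleC_add_left scaleC_scaleC mult.commute flip: scaleC_of_real)
    then have "l (c *\<^sub>C y) = (of_real (Re c) + \<i> * of_real (Im c)) * l y"
      by (simp add: add real i algebra_simps)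
    then show ?thesis by (simp flip: complex_eq)
  qed
  have bound: "cmod (l y) \<le> norm y" for y
  proof (cases "l y = 0")
    case False
    define c where "c = cnj (l y) / cmod (l y)"
    have "l (c *\<^sub>C y) = cmod (l y)"
      using False unfolding scale c_def
      by (simp add: field_simps complex_norm_square power2_eq_square
          flip: complex_norm_square of_real_mult)
    then have "cmod (l y) = r (c *\<^sub>C y)"
      by (simp add: l_def complex_eq_iff)
    also have "\<dots> \<le> norm (c *\<^sub>C y)"
      using le[of "c *\<^sub>C y"] by simp
    also have "\<dots> = norm y"
      using False by (simp add: norm_scaleC c_def norm_divide)
    finally show ?thesis .
  qed simp
  have "bounded_linear l"
    using bound by (intro bounded_linear_intro[where K = 1])
      (simp_all add: add real scaleR_conv_of_real)
  then have "bounded_clinear l"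
    by (rule bounded_clinearI) (simp add: scale scaleC_complex_def)
  moreover have "l x = of_real (norm x)"
  proof -
    have re: "Re (l x) = norm x" by (simp add: l_def rx)
    moreover have "Im (l x) = 0"
    proof -
      have "(Re (l x))\<^sup>2 + (Im (l x))\<^sup>2 \<le> (norm x)\<^sup>2"
        using bound[of x] power_mono[of "cmod (l x)" "norm x" 2] by (simp add: cmod_power2)
      then show ?thesis using re by simp
    qed
    ultimately show ?thesis by (simp add: complex_eq_iff)
  qed
  ultimately show ?thesis using that bound by blast
qed

section \<open>Holomorphic maps on complex lines\<close>

lemma fderiv_eqI:
  assumes "(F has_derivative blinfun_apply A) (at z)"
  shows "fderiv F z = A"
  using frechet_derivative_at[OF assms] by (metis fderiv_def blinfun_apply_inverse)

lemma frechet_holomorphic_onD: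
  assumes F: "F frechet_holomorphic_on S" and S: "open S" "z \<in> S"
  shows "(F has_derivative blinfun_apply (fderiv F z)) (at z)"
    and "blinfun_apply (fderiv F z) (c *\<^sub>C v) = c *\<^sub>C blinfun_apply (fderiv F z) v"
proof -
  obtain A where A: "bounded_clinear A" "(F has_derivative A) (at z)"
    using F S(2) unfolding frechet_holomorphic_on_def
    by (metis at_within_open[OF S(2,1)])
  then have bl: "bounded_linear A" and hom: "A (c *\<^sub>C v) = c *\<^sub>C A v"
    unfolding bounded_clinear_def by blast+
  have A_eq: "blinfun_apply (Blinfun A) = A"
    using bl by (rule bounded_linear_Blinfun_apply)
  have "fderiv F z = Blinfun A"
    using A(2) by (intro fderiv_eqI) (simp only: A_eq)
  then have D_eq: "blinfun_apply (fderiv F z) = A"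
    using A_eq by metis
  show "(F has_derivative blinfun_apply (fderiv F z)) (at z)"
    using A(2) unfolding D_eq .
  show "blinfun_apply (fderiv F z) (c *\<^sub>C v) = c *\<^sub>C blinfun_apply (fderiv F z) v"
    using hom unfolding D_eq .
qed

lemma frechet_holomorphic_onI:
  assumes "\<And>z. z \<in> S \<Longrightarrow> (F has_derivative A z) (at z)"
    and "\<And>z c v. z \<in> S \<Longrightarrow> A z (c *\<^sub>C v) = c *\<^sub>C A z v"
  shows "F frechet_holomorphic_on S"
  unfolding frechet_holomorphic_on_def
proof
  fix z assume z: "z \<in> S"
  have "bounded_clinear (A z)"
    using has_derivative_bounded_linear[OF assms(1)[OF z]] assms(2)[OF z]
    by (rule bounded_clinearI)
  with assms(1)[OF z] show "\<exists>A. bounded_clinear A \<and> (F has_derivative A) (at z within S)"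
    by (blast intro: has_derivative_at_withinI)
qed

lemma frechet_holomorphic_on_subset:
  assumes "F frechet_holomorphic_on S" "T \<subseteq> S"
  shows "F frechet_holomorphic_on T"
  using assms unfolding frechet_holomorphic_on_def by (meson has_derivative_subset subsetD)

lemma has_field_derivative_along_line:
  fixes F :: "'a::complex_normed_vector \<Rightarrow> 'b::complex_normed_vector"
  assumes F: "F frechet_holomorphic_on S" and S: "open S" "a + \<zeta> *\<^sub>C v \<in> S"
    and l: "bounded_clinear l"
  shows "((\<lambda>\<zeta>. l (F (a + \<zeta> *\<^sub>C v))) has_field_derivative
           l (blinfun_apply (fderiv F (a + \<zeta> *\<^sub>C v)) v)) (at \<zeta>)"
proof -
  have line: "((\<lambda>\<zeta>. a + \<zeta> *\<^sub>C v) has_derivative (\<lambda>t. t *\<^sub>C v)) (at \<zeta>)"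
    by (auto intro!: derivative_eq_intros bounded_linear.has_derivative[OF scaleC.bounded_linear_left])
  have l': "bounded_linear l" "l (c *\<^sub>C x) = c * l x" for c x
    using l by (auto simp: bounded_clinear_def scaleC_complex_def)
  have "((\<lambda>\<zeta>. l (F (a + \<zeta> *\<^sub>C v))) has_derivative
      (\<lambda>t. l (blinfun_apply (fderiv F (a + \<zeta> *\<^sub>C v)) (t *\<^sub>C v)))) (at \<zeta>)"
    using bounded_linear.has_derivative[OF l'(1)
        has_derivative_compose[OF line frechet_holomorphic_onD(1)[OF F S]]] .
  then show ?thesis
    by (rule has_derivative_imp_has_field_derivative)
      (simp add: frechet_holomorphic_onD(2)[OF F S] l'(2))
qed

text \<open>Cauchy's inequalities bound every Taylor coefficient by \<open>M\<close>, so that the remainder of second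
  order is dominated by a geometric series of ratio \<open>1/2\<close>.\<close>

lemma cauchy_estimates:
  fixes \<phi> :: "complex \<Rightarrow> complex"
  assumes hol: "\<phi> holomorphic_on ball 0 2" and bound: "\<And>\<zeta>. \<zeta> \<in> ball 0 2 \<Longrightarrow> cmod (\<phi> \<zeta>) \<le> M"
  shows "cmod (deriv \<phi> 0) \<le> M"
    and "cmod \<zeta> \<le> 1/2 \<Longrightarrow> cmod (\<phi> \<zeta> - \<phi> 0 - deriv \<phi> 0 * \<zeta>) \<le> 2 * M * (cmod \<zeta>)\<^sup>2"
proof -
  define a where "a n = (deriv ^^ n) \<phi> 0 / fact n" for n
  have "cball (0::complex) 1 \<subseteq> ball 0 2" "ball (0::complex) 1 \<subseteq> ball 0 2"
    by auto
  then have hol1: "\<phi> holomorphic_on ball 0 1" "continuous_on (cball 0 1) \<phi>"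
    using hol by (auto intro: holomorphic_on_subset holomorphic_on_imp_continuous_on)
  have "cmod ((deriv ^^ n) \<phi> 0) \<le> fact n * M / 1 ^ n" for n
    by (rule Cauchy_inequality[OF hol1]) (auto intro: bound)
  then have a: "cmod (a n) \<le> M" for n
    by (simp add: a_def norm_divide divide_le_eq mult.commute)
  show "cmod (deriv \<phi> 0) \<le> M"
    using a[of 1] by (simp add: a_def)
  have M: "M \<ge> 0"
    using a[of 0] norm_ge_zero[of "a 0"] by linarith
  assume z: "cmod \<zeta> \<le> 1/2"
  have "(\<lambda>n. a n * (\<zeta> - 0) ^ n) sums \<phi> \<zeta>"
    unfolding a_def using z by (intro holomorphic_power_series[OF hol1(1)]) auto
  then have "(\<lambda>n. a (n + 2) * \<zeta> ^ (n + 2)) sums (\<phi> \<zeta> - (\<Sum>n<2. a n * \<zeta> ^ n))"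
    using sums_iff_shift[of "\<lambda>n. a n * \<zeta> ^ n" 2] by simp
  moreover have "(\<Sum>n<2. a n * \<zeta> ^ n) = \<phi> 0 + deriv \<phi> 0 * \<zeta>"
    by (simp add: a_def numeral_2_eq_2)
  ultimately have tail: "(\<lambda>n. a (n + 2) * \<zeta> ^ (n + 2)) sums (\<phi> \<zeta> - \<phi> 0 - deriv \<phi> 0 * \<zeta>)"
    by (simp add: diff_diff_add)
  have geo: "(\<lambda>n. M * (cmod \<zeta>)\<^sup>2 * (1/2) ^ n) sums (M * (cmod \<zeta>)\<^sup>2 * 2)"
    using sums_mult[OF geometric_sums[of "1/2::real"], of "M * (cmod \<zeta>)\<^sup>2"] by simp
  have "cmod (a (n + 2) * \<zeta> ^ (n + 2)) \<le> M * (cmod \<zeta>)\<^sup>2 * (1/2) ^ n" for n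
  proof -
    have "cmod (a (n + 2) * \<zeta> ^ (n + 2)) = cmod (a (n + 2)) * ((cmod \<zeta>)\<^sup>2 * cmod \<zeta> ^ n)"
      by (simp add: norm_mult norm_power power_add power2_eq_square)
    also have "\<dots> \<le> M * ((cmod \<zeta>)\<^sup>2 * (1/2) ^ n)"
      using a z M by (intro mult_mono power_mono) auto
    finally show ?thesis by simp
  qed
  then have "cmod (\<Sum>n. a (n + 2) * \<zeta> ^ (n + 2)) \<le> (\<Sum>n. M * (cmod \<zeta>)\<^sup>2 * (1/2) ^ n)"
    using geo by (intro norm_suminf_le) (auto simp: sums_iff)
  then show "cmod (\<phi> \<zeta> - \<phi> 0 - deriv \<phi> 0 * \<zeta>) \<le> 2 * M * (cmod \<zeta>)\<^sup>2"
    using tail geo by (simp add: sums_iff)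
qed

text \<open>A vector estimate follows from the scalar one by restricting the map to a complex line and
  composing it with a functional that norms the vector in question. The directions are scaled to
  length \<open>R / 2\<close>, because the scalar functions live on the disc of radius \<open>2\<close>.\<close>

lemma frechet_cauchy_estimates:
  fixes F :: "'a::complex_normed_vector \<Rightarrow> 'b::complex_normed_vector"
  assumes F: "F frechet_holomorphic_on ball w R" and R: "R > 0"
    and bound: "\<And>x. x \<in> ball w R \<Longrightarrow> norm (F x) \<le> M"
  shows "norm (fderiv F w) \<le> 2 * M / R"
    and "norm h \<le> R / 4 \<Longrightarrow>
      norm (F (w + h) - F w - blinfun_apply (fderiv F w) h) \<le> 8 * M / R\<^sup>2 * (norm h)\<^sup>2"
proof -
  have scalar: "norm (blinfun_apply (fderiv F w) u) \<le> M"
    "cmod \<zeta> \<le> 1/2 \<Longrightarrow>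
      norm (F (w + \<zeta> *\<^sub>C u) - F w - blinfun_apply (fderiv F w) (\<zeta> *\<^sub>C u)) \<le> 2 * M * (cmod \<zeta>)\<^sup>2"
    if u: "norm u = R / 2" for u \<zeta>
  proof -
    have main: "cmod (l (blinfun_apply (fderiv F w) u)) \<le> M"
      "cmod \<zeta> \<le> 1/2 \<Longrightarrow> cmod (l (F (w + \<zeta> *\<^sub>C u) - F w - blinfun_apply (fderiv F w) (\<zeta> *\<^sub>C u)))
        \<le> 2 * M * (cmod \<zeta>)\<^sup>2"
      if l: "bounded_clinear l" "\<And>y. cmod (l y) \<le> norm y" for l
    proof -
      define \<phi> where "\<phi> \<zeta> = l (F (w + \<zeta> *\<^sub>C u))" for \<zeta>
      have inball: "w + \<zeta> *\<^sub>C u \<in> ball w R" if "\<zeta> \<in> ball 0 2" for \<zeta>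
        using that R by (simp add: dist_norm norm_scaleC u)
      have deriv: "(\<phi> has_field_derivative l (blinfun_apply (fderiv F (w + \<zeta> *\<^sub>C u)) u)) (at \<zeta>)"
        if "\<zeta> \<in> ball 0 2" for \<zeta>
        unfolding \<phi>_def using F inball[OF that] l(1)
        by (intro has_field_derivative_along_line[where S = "ball w R"]) auto
      have hol: "\<phi> holomorphic_on ball 0 2"
        unfolding holomorphic_on_open[OF open_ball] using deriv by blast
      have b: "cmod (\<phi> \<zeta>) \<le> M" if "\<zeta> \<in> ball 0 2" for \<zeta>
        unfolding \<phi>_def using l(2) bound[OF inball[OF that]] by (rule order_trans)
      have d0: "deriv \<phi> 0 = l (blinfun_apply (fderiv F w) u)"
        using DERIV_imp_deriv[OF deriv[of 0]] by simp
      show "cmod (l (blinfun_apply (fderiv F w) u)) \<le> M"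
        using cauchy_estimates(1)[OF hol b] d0 by simp
      have "w \<in> ball w R" using R by simp
      then have hom: "blinfun_apply (fderiv F w) (\<zeta> *\<^sub>C u) = \<zeta> *\<^sub>C blinfun_apply (fderiv F w) u"
        by (intro frechet_holomorphic_onD(2)[OF F]) auto
      have "l (F (w + \<zeta> *\<^sub>C u) - F w - blinfun_apply (fderiv F w) (\<zeta> *\<^sub>C u))
          = \<phi> \<zeta> - \<phi> 0 - deriv \<phi> 0 * \<zeta>"
        using l(1) unfolding hom d0
        by (simp add: \<phi>_def bounded_clinear_def scaleC_complex_def linear_diff
            bounded_linear.linear)
      then show "cmod (l (F (w + \<zeta> *\<^sub>C u) - F w - blinfun_apply (fderiv F w) (\<zeta> *\<^sub>C u)))
        \<le> 2 * M * (cmod \<zeta>)\<^sup>2" if "cmod \<zeta> \<le> 1/2"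
        using cauchy_estimates(2)[OF hol b that] by simp
    qed
    show "norm (blinfun_apply (fderiv F w) u) \<le> M"
    proof -
      obtain l where l: "bounded_clinear l" "\<And>y. cmod (l y) \<le> norm y"
        "l (blinfun_apply (fderiv F w) u) = of_real (norm (blinfun_apply (fderiv F w) u))"
        by (rule norming_functional_exists[of "blinfun_apply (fderiv F w) u"]) blast
      then show ?thesis using main(1)[OF l(1,2)] by simp
    qed
    show "norm (F (w + \<zeta> *\<^sub>C u) - F w - blinfun_apply (fderiv F w) (\<zeta> *\<^sub>C u))
        \<le> 2 * M * (cmod \<zeta>)\<^sup>2" if "cmod \<zeta> \<le> 1/2"
    proof -
      obtain l where l: "bounded_clinear l" "\<And>y. cmod (l y) \<le> norm y"
        "l (F (w + \<zeta> *\<^sub>C u) - F w - blinfun_apply (fderiv F w) (\<zeta> *\<^sub>C u))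
          = of_real (norm (F (w + \<zeta> *\<^sub>C u) - F w - blinfun_apply (fderiv F w) (\<zeta> *\<^sub>C u)))"
        by (rule norming_functional_exists[of "F (w + \<zeta> *\<^sub>C u) - F w - blinfun_apply (fderiv F w) (\<zeta> *\<^sub>C u)"]) blast
      then show ?thesis using main(2)[OF l(1,2) that] by simp
    qed
  qed
  have M: "M \<ge> 0"
    using bound[of w] norm_ge_zero[of "F w"] R by (metis centre_in_ball order_trans)
  have direction: "norm ((R / (2 * norm h)) *\<^sub>R h) = R / 2"
    "h = complex_of_real (2 * norm h / R) *\<^sub>C (R / (2 * norm h)) *\<^sub>R h" if "h \<noteq> 0" for h :: 'a
    unfolding scaleC_of_real using that R by auto
  show "norm (fderiv F w) \<le> 2 * M / R"
  proof (rule norm_blinfun_bound)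
    fix h
    show "norm (blinfun_apply (fderiv F w) h) \<le> 2 * M / R * norm h"
    proof (cases "h = 0")
      case False
      then have "R / (2 * norm h) * norm (blinfun_apply (fderiv F w) h) \<le> M"
        using scalar(1)[OF direction(1)[OF False]] R
        by (simp add: blinfun.scaleR_right)
      then show ?thesis using False R by (simp add: field_simps)
    qed simp
  qed (use M R in simp)
  show "norm (F (w + h) - F w - blinfun_apply (fderiv F w) h) \<le> 8 * M / R\<^sup>2 * (norm h)\<^sup>2"
    if h: "norm h \<le> R / 4"
  proof (cases "h = 0")
    case False
    have "cmod (complex_of_real (2 * norm h / R)) = 2 * norm h / R"
      using R by (simp only: norm_of_real) simp
    moreover have "2 * norm h / R \<le> 1/2"
      using h R by (simp add: field_simps)
    ultimately have "norm (F (w + h) - F w - blinfun_apply (fderiv F w) h) \<le> 2 * M * (2 * norm h / R)\<^sup>2"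
      using scalar(2)[OF direction(1)[OF False], of "complex_of_real (2 * norm h / R)"]
      by (metis direction(2)[OF False])
    then show ?thesis by (simp add: power_divide power_mult_distrib)
  qed simp
qed

section \<open>Derivatives of holomorphic maps are holomorphic\<close>

text \<open>Difference quotients whose mutual distance is controlled linearly converge, by completeness, and
  the limit inherits the rate. This rate later becomes the remainder estimate of a derivative.\<close>

lemma limit_at_zero_with_rate:
  fixes P :: "real \<Rightarrow> 'b::banach"
  assumes \<delta>: "\<delta> > 0" and c: "c \<ge> 0"
    and P: "\<And>s t. 0 < s \<Longrightarrow> s \<le> \<delta> \<Longrightarrow> 0 < t \<Longrightarrow> t \<le> \<delta> \<Longrightarrow> norm (P s - P t) \<le> c * (s + t)"
  obtains L where "\<And>s. 0 < s \<Longrightarrow> s \<le> \<delta> \<Longrightarrow> norm (P s - L) \<le> c * s"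
proof -
  define t where "t n = \<delta> / real (Suc n)" for n
  have t: "0 < t n" "t n \<le> \<delta>" for n
    using \<delta> by (auto simp: t_def field_simps)
  have t0: "t \<longlonglongrightarrow> 0"
    using tendsto_mult_right_zero[OF LIMSEQ_inverse_real_of_nat, of \<delta>]
    by (simp add: t_def[abs_def] divide_inverse)
  have "Cauchy (\<lambda>n. P (t n))"
  proof (rule CauchyI)
    fix e :: real assume e: "e > 0"
    have "(\<lambda>n. c * t n) \<longlonglongrightarrow> 0"
      using tendsto_mult_right_zero[OF t0] .
    then have "eventually (\<lambda>n. c * t n < e / 2) sequentially"
      using e by (intro order_tendstoD(2)) auto
    then obtain N where N: "\<And>n. n \<ge> N \<Longrightarrow> c * t n < e / 2"
      by (auto simp: eventually_sequentially)
    have "norm (P (t m) - P (t n)) < e" if "m \<ge> N" "n \<ge> N" for m n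
      using P[OF t t, of m n] N[OF that(1)] N[OF that(2)] by (simp add: algebra_simps)
    then show "\<exists>M. \<forall>m\<ge>M. \<forall>n\<ge>M. norm (P (t m) - P (t n)) < e" by blast
  qed
  then obtain L where L: "(\<lambda>n. P (t n)) \<longlonglongrightarrow> L"
    by (auto simp: Cauchy_convergent_iff convergent_def)
  show ?thesis
  proof
    fix s assume s: "0 < s" "s \<le> \<delta>"
    have "(\<lambda>n. norm (P s - P (t n))) \<longlonglongrightarrow> norm (P s - L)"
      by (intro tendsto_intros L)
    moreover have "(\<lambda>n. c * (s + t n)) \<longlonglongrightarrow> c * (s + 0)"
      by (intro tendsto_intros t0)
    ultimately show "norm (P s - L) \<le> c * s"
      using P[OF s t] by (intro LIMSEQ_le[of _ _ _ "c * s"]) auto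
  qed
qed

lemma blinfun_eq_0_if_quadratic:
  fixes A :: "'a::real_normed_vector \<Rightarrow>\<^sub>L 'b::real_normed_vector"
  assumes \<rho>: "\<rho> > 0" and A: "\<And>h. norm h \<le> \<rho> \<Longrightarrow> norm (blinfun_apply A h) \<le> C * (norm h)\<^sup>2"
  shows "A = 0"
proof (rule blinfun_eqI)
  fix h
  have ev: "norm (blinfun_apply A h) \<le> C * (norm h)\<^sup>2 * t" if t: "0 < t" "t * norm h \<le> \<rho>" for t
    using A[of "t *\<^sub>R h"] t
    by (simp add: blinfun.scaleR_right power2_eq_square field_simps)
  have "eventually (\<lambda>t. t * norm h < \<rho>) (at_right 0)"
    using \<rho> by (intro order_tendstoD(2)[of _ 0] tendsto_mult_left_zero tendsto_ident_at)
  then have "eventually (\<lambda>t. norm (blinfun_apply A h) \<le> C * (norm h)\<^sup>2 * t) (at_right 0)"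
    using eventually_at_right_less[of "0::real"] by eventually_elim (auto intro: ev)
  moreover have "((\<lambda>t. C * (norm h)\<^sup>2 * t) \<longlongrightarrow> C * (norm h)\<^sup>2 * 0) (at_right 0)"
    by (intro tendsto_intros)
  ultimately have "norm (blinfun_apply A h) \<le> C * (norm h)\<^sup>2 * 0"
    by (intro tendsto_lowerbound) auto
  then show "blinfun_apply A h = blinfun_apply 0 h" by simp
qed

text \<open>The difference quotients \<open>G v s w = (F (w + s v) - F w) / s\<close> are holomorphic in \<open>w\<close> and converge
  to \<open>DF(w) v\<close> uniformly near \<open>z\<close>, with an error of order \<open>s\<close>. Cauchy's estimate turns this into
  convergence of their derivatives \<open>P v s = (DF(z + s v) - DF(z)) / s\<close> in operator norm, to some
  operator \<open>B v\<close>, again with an error of order \<open>s\<close>. For \<open>s = 1\<close> this says that \<open>DF(z + v)\<close> equals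
  \<open>DF(z) + B v\<close> up to an error of order \<open>\<parallel>v\<parallel>\<^sup>2\<close>.

  It remains to see that \<open>B\<close> is complex-linear. The second-order estimate for \<open>G v s\<close> yields, as
  \<open>s\<close> tends to \<open>0\<close>, that \<open>B v h\<close> is the linear part in \<open>h\<close> of \<open>(DF(z + h) - DF(z)) v\<close>. The latter
  is linear in \<open>v\<close>, and a linear part is unique.\<close>

theorem frechet_holomorphic_on_fderiv:
  fixes F :: "'a::complex_normed_vector \<Rightarrow> 'b::complex_banach"
  assumes F: "F frechet_holomorphic_on S" and S: "open S"
  shows "fderiv F frechet_holomorphic_on S"
proof -
  have "\<exists>B. (fderiv F has_derivative B) (at z) \<and> (\<forall>c v. B (c *\<^sub>C v) = c *\<^sub>C B v)"
    if z: "z \<in> S" for z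
  proof -
    let ?D = "\<lambda>w. blinfun_apply (fderiv F w)"
    note deriv = frechet_holomorphic_onD[OF F S]
    obtain R M where R: "R > 0" and RS: "ball z (3 * R) \<subseteq> S"
      and M: "\<And>w. w \<in> ball z (3 * R) \<Longrightarrow> norm (F w) \<le> M"
    proof -
      have "isCont F z"
        using deriv(1)[OF z] by (rule has_derivative_continuous)
      then have "(F \<longlongrightarrow> F z) (nhds z)"
        by (simp add: isCont_def tendsto_at_iff_tendsto_nhds)
      then have "\<forall>\<^sub>F w in nhds z. norm (F w) < norm (F z) + 1"
        by (intro order_tendstoD(2)[OF tendsto_norm]) auto
      moreover have "\<forall>\<^sub>F w in nhds z. w \<in> S"
        using S z by (rule eventually_nhds_in_open)
      ultimately have "\<forall>\<^sub>F w in nhds z. w \<in> S \<and> norm (F w) < norm (F z) + 1"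
        by eventually_elim simp
      then obtain d where "d > 0" "\<And>w. dist w z < d \<Longrightarrow> w \<in> S \<and> norm (F w) < norm (F z) + 1"
        by (auto simp: eventually_nhds_metric)
      then show ?thesis
        by (intro that[of "d / 3" "norm (F z) + 1"]) (auto simp: dist_commute less_imp_le)
    qed
    define K where "K = 8 * M / R\<^sup>2"
    have M0: "M \<ge> 0"
      using M[of z] R norm_ge_zero[of "F z"] by (metis centre_in_ball order_trans mult_pos_pos zero_less_numeral)
    have K: "K \<ge> 0"
      using M0 by (simp add: K_def)
    have near: "ball w R \<subseteq> ball z (3 * R)" if "w \<in> ball z (2 * R)" for w
    proof
      fix x assume "x \<in> ball w R"
      then show "x \<in> ball z (3 * R)"
        using that dist_triangle[of z x w] by (simp add: dist_commute)
    qed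
    have est: "norm (fderiv F w) \<le> 2 * M / R"
      "norm h \<le> R / 4 \<Longrightarrow> norm (F (w + h) - F w - ?D w h) \<le> K * (norm h)\<^sup>2"
      if w: "w \<in> ball z (2 * R)" for w h
      unfolding K_def using near[OF w] RS R M
      by (intro frechet_cauchy_estimates frechet_holomorphic_on_subset[OF F]; blast)+
    define G where "G v s w = (1 / s) *\<^sub>R (F (w + s *\<^sub>R v) - F w)" for v and s :: real and w
    define P where "P v s = (1 / s) *\<^sub>R (fderiv F (z + s *\<^sub>R v) - fderiv F z)" for v and s :: real
    have shift: "w + s *\<^sub>R v \<in> S" "w \<in> S"
      if "w \<in> ball z (2 * R)" "s > 0" "s * norm v \<le> R / 4" for w s v
    proof -
      have "w + s *\<^sub>R v \<in> ball w R" "w \<in> ball w R"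
        using that R by (auto simp: dist_norm)
      with near[OF that(1)] RS show "w + s *\<^sub>R v \<in> S" "w \<in> S"
        by blast+
    qed
    have G_deriv: "(G v s has_derivative
        blinfun_apply ((1 / s) *\<^sub>R (fderiv F (w + s *\<^sub>R v) - fderiv F w))) (at w)"
      if "w \<in> ball z (2 * R)" "s > 0" "s * norm v \<le> R / 4" for v s w
    proof -
      note sh = shift[OF that]
      have "((\<lambda>w. F (w + s *\<^sub>R v)) has_derivative ?D (w + s *\<^sub>R v)) (at w)"
        using has_derivative_compose[OF has_derivative_add_const[OF has_derivative_ident],
          of F "?D (w + s *\<^sub>R v)" w "s *\<^sub>R v"] deriv(1)[OF sh(1)] by simp
      from has_derivative_scaleR_right[OF has_derivative_diff[OF this deriv(1)[OF sh(2)]], of "1 / s"]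
      show ?thesis
        unfolding G_def by (simp add: scaleR_blinfun.rep_eq minus_blinfun.rep_eq)
    qed
    have G_hol: "G v s frechet_holomorphic_on ball z (2 * R)"
      if "s > 0" "s * norm v \<le> R / 4" for v s
      using G_deriv[OF _ that]
    proof (rule frechet_holomorphic_onI)
      fix w c u assume w: "w \<in> ball z (2 * R)"
      show "blinfun_apply ((1 / s) *\<^sub>R (fderiv F (w + s *\<^sub>R v) - fderiv F w)) (c *\<^sub>C u)
          = c *\<^sub>C blinfun_apply ((1 / s) *\<^sub>R (fderiv F (w + s *\<^sub>R v) - fderiv F w)) u"
        using shift[OF w that] deriv(2)
        by (simp add: blinfun.scaleR_left blinfun.diff_left scaleC.scaleR_right scaleC.diff_right)
    qed
    have G_fderiv: "fderiv (G v s) z = P v s" if "s > 0" "s * norm v \<le> R / 4" for v s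
      unfolding P_def using R that by (intro fderiv_eqI G_deriv) auto
    have G_close: "norm (G v s w - ?D w v) \<le> K * (norm v)\<^sup>2 * s"
      if w: "w \<in> ball z (2 * R)" and s: "s > 0" "s * norm v \<le> R / 4" for v s w
    proof -
      have "G v s w - ?D w v = (1 / s) *\<^sub>R (F (w + s *\<^sub>R v) - F w - ?D w (s *\<^sub>R v))"
        using s by (simp add: G_def scaleR_diff_right blinfun.scaleR_right)
      then have "norm (G v s w - ?D w v) \<le> (1 / s) * (K * (norm (s *\<^sub>R v))\<^sup>2)"
        using s est(2)[OF w, of "s *\<^sub>R v"] by (simp add: divide_right_mono)
      also have "\<dots> = K * (norm v)\<^sup>2 * s"
        using s by (simp add: power2_eq_square)
      finally show ?thesis .
    qed
    have P_cauchy: "norm (P v s - P v t) \<le> K * (norm v)\<^sup>2 / R * (s + t)"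
      if s: "s > 0" "s * norm v \<le> R / 4" and t: "t > 0" "t * norm v \<le> R / 4" for v s t
    proof -
      let ?H = "\<lambda>w. G v s w - G v t w"
      have d: "(?H has_derivative blinfun_apply (fderiv (G v s) w - fderiv (G v t) w)) (at w)"
        if "w \<in> ball z (2 * R)" for w
        unfolding minus_blinfun.rep_eq using G_hol s t that
        by (intro has_derivative_diff frechet_holomorphic_onD(1)[of _ "ball z (2 * R)"]) auto
      have hol: "?H frechet_holomorphic_on ball z (2 * R)"
        using d
      proof (rule frechet_holomorphic_onI)
        fix w c u assume w: "w \<in> ball z (2 * R)"
        show "blinfun_apply (fderiv (G v s) w - fderiv (G v t) w) (c *\<^sub>C u)
          = c *\<^sub>C blinfun_apply (fderiv (G v s) w - fderiv (G v t) w) u"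
          using frechet_holomorphic_onD(2)[OF G_hol[OF s] open_ball w]
            frechet_holomorphic_onD(2)[OF G_hol[OF t] open_ball w]
          by (simp add: blinfun.diff_left scaleC.diff_right)
      qed
      have "norm (?H w) \<le> K * (norm v)\<^sup>2 * (s + t)" if w: "w \<in> ball z (2 * R)" for w
      proof -
        have "norm (?H w) \<le> norm (G v s w - ?D w v) + norm (G v t w - ?D w v)"
          using norm_triangle_ineq4[of "G v s w - ?D w v" "G v t w - ?D w v"] by simp
        with G_close[OF w s] G_close[OF w t] show ?thesis
          by (simp add: algebra_simps)
      qed
      then have "norm (fderiv ?H z) \<le> 2 * (K * (norm v)\<^sup>2 * (s + t)) / (2 * R)"
        using R by (intro frechet_cauchy_estimates(1)[OF hol]) auto
      moreover have "fderiv ?H z = P v s - P v t"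
        using fderiv_eqI[OF d[of z]] R G_fderiv[OF s] G_fderiv[OF t] by simp
      ultimately show ?thesis by simp
    qed
    have "\<exists>B. \<forall>s>0. s * norm v \<le> R / 4 \<longrightarrow> norm (P v s - B) \<le> K * (norm v)\<^sup>2 / R * s" for v
    proof -
      \<comment> \<open>For nonzero \<open>v\<close>, the condition \<open>s \<le> \<delta>\<close> is exactly \<open>s * norm v \<le> R / 4\<close>.\<close>
      define \<delta> where "\<delta> = (if v = 0 then 1 else R / 4 / norm v)"
      have \<delta>: "\<delta> > 0" "s \<le> \<delta> \<longleftrightarrow> s * norm v \<le> R / 4" if "v \<noteq> 0 \<or> s \<le> 1" for s
        using R that by (auto simp: \<delta>_def field_simps)
      show ?thesis
      proof (cases "v = 0")
        case True
        then show ?thesis by (auto simp: P_def)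
      next
        case False
        have "norm (P v s - P v t) \<le> K * (norm v)\<^sup>2 / R * (s + t)"
          if "0 < s" "s \<le> \<delta>" "0 < t" "t \<le> \<delta>" for s t
          using that False \<delta>(2) by (intro P_cauchy) auto
        moreover have "K * (norm v)\<^sup>2 / R \<ge> 0"
          using K R by simp
        ultimately obtain B where "\<And>s. 0 < s \<Longrightarrow> s \<le> \<delta> \<Longrightarrow> norm (P v s - B) \<le> K * (norm v)\<^sup>2 / R * s"
          using limit_at_zero_with_rate[of \<delta> "K * (norm v)\<^sup>2 / R" "P v"] \<delta>(1) False by blast
        then show ?thesis using False \<delta>(2) by blast
      qed
    qed
    then obtain B where B: "\<And>v s. s > 0 \<Longrightarrow> s * norm v \<le> R / 4 \<Longrightarrow>
        norm (P v s - B v) \<le> K * (norm v)\<^sup>2 / R * s"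
      by metis
    have remainder: "norm (fderiv F (z + v) - fderiv F z - B v) \<le> K / R * (norm v)\<^sup>2"
      if "norm v \<le> R / 4" for v
      using B[of 1 v] that by (simp add: P_def)
    define C where "C = 2 * (2 * M / R + K * R / 4) / R\<^sup>2"
    have G_bound: "norm (G v s w) \<le> (2 * M / R + K * R / 4) * norm v"
      if w: "w \<in> ball z (2 * R)" and s: "s > 0" "s * norm v \<le> R / 4" for v s w
    proof -
      have "norm (G v s w) \<le> norm (?D w v) + norm (G v s w - ?D w v)"
        using norm_triangle_ineq[of "?D w v" "G v s w - ?D w v"] by simp
      also have "\<dots> \<le> 2 * M / R * norm v + K * norm v * (s * norm v)"
        using G_close[OF w s] est(1)[OF w]
        by (intro add_mono norm_blinfun[THEN order_trans] mult_right_mono)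
          (auto simp: power2_eq_square mult.commute mult.left_commute)
      also have "\<dots> \<le> 2 * M / R * norm v + K * norm v * (R / 4)"
        using s K by (intro add_left_mono mult_left_mono) auto
      finally show ?thesis by (simp add: algebra_simps)
    qed
    \<comment> \<open>The symmetric description of \<open>B\<close>: here the increment of the point is \<open>h\<close>, and \<open>v\<close> is the argument.\<close>
    have second: "norm (?D (z + h) v - ?D z v - blinfun_apply (B v) h) \<le> C * norm v * (norm h)\<^sup>2"
      if h: "norm h \<le> R / 2" for h v
    proof -
      have ev: "\<forall>\<^sub>F s in at_right 0. s > 0 \<and> s * norm v \<le> R / 4"
      proof -
        have "\<forall>\<^sub>F s in at_right 0. s * norm v < R / 4"
          using R by (intro order_tendstoD(2)[of _ 0] tendsto_mult_left_zero tendsto_ident_at) auto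
        then show ?thesis
          using eventually_at_right_less[of "0::real"] by eventually_elim auto
      qed
      have lim0: "((\<lambda>s. a * s) \<longlongrightarrow> 0) (at_right 0)" for a :: real
        by (intro tendsto_mult_right_zero tendsto_ident_at)
      have Glim: "((\<lambda>s. G v s w) \<longlongrightarrow> ?D w v) (at_right 0)" if w: "w \<in> ball z (2 * R)" for w
      proof (rule Lim_null[THEN iffD2], rule Lim_null_comparison)
        show "\<forall>\<^sub>F s in at_right 0. norm (G v s w - ?D w v) \<le> K * (norm v)\<^sup>2 * s"
          using ev by eventually_elim (use G_close[OF w] in auto)
      qed (rule lim0)
      have Plim: "((\<lambda>s. P v s) \<longlongrightarrow> B v) (at_right 0)"
      proof (rule Lim_null[THEN iffD2], rule Lim_null_comparison)
        show "\<forall>\<^sub>F s in at_right 0. norm (P v s - B v) \<le> K * (norm v)\<^sup>2 / R * s"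
          using ev by eventually_elim (use B in auto)
      qed (rule lim0)
      have "z + h \<in> ball z (2 * R)" "z \<in> ball z (2 * R)"
        using h R by (auto simp: dist_norm)
      then have "((\<lambda>s. norm (G v s (z + h) - G v s z - blinfun_apply (P v s) h)) \<longlongrightarrow>
          norm (?D (z + h) v - ?D z v - blinfun_apply (B v) h)) (at_right 0)"
        by (intro tendsto_intros Glim Plim blinfun.tendsto)
      moreover have "\<forall>\<^sub>F s in at_right 0.
          norm (G v s (z + h) - G v s z - blinfun_apply (P v s) h) \<le> C * norm v * (norm h)\<^sup>2"
        using ev
      proof eventually_elim
        fix s assume s: "s > 0 \<and> s * norm v \<le> R / 4"
        have "norm (G v s (z + h) - G v s z - blinfun_apply (fderiv (G v s) z) h)
            \<le> 8 * ((2 * M / R + K * R / 4) * norm v) / (2 * R)\<^sup>2 * (norm h)\<^sup>2"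
          using s R h G_hol G_bound by (intro frechet_cauchy_estimates(2)) auto
        also have "\<dots> = C * norm v * (norm h)\<^sup>2"
          using R by (simp add: C_def power2_eq_square field_simps)
        finally show "norm (G v s (z + h) - G v s z - blinfun_apply (P v s) h)
            \<le> C * norm v * (norm h)\<^sup>2"
          using s G_fderiv by simp
      qed
      ultimately show ?thesis
        by (intro tendsto_upperbound) auto
    qed
    have B_add: "B (u + v) = B u + B v" for u v
    proof -
      have "B (u + v) - (B u + B v) = 0"
      proof (rule blinfun_eq_0_if_quadratic)
        fix h :: 'a assume h: "norm h \<le> R / 2"
        let ?E = "\<lambda>v. ?D (z + h) v - ?D z v - blinfun_apply (B v) h"
        have "blinfun_apply (B (u + v) - (B u + B v)) h = ?E u + ?E v - ?E (u + v)"
          by (simp add: blinfun.diff_left blinfun.add_left blinfun.add_right)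
        also have "norm \<dots> \<le> norm (?E u) + norm (?E v) + norm (?E (u + v))"
          by norm
        also have "\<dots> \<le> (C * norm u + C * norm v + C * norm (u + v)) * (norm h)\<^sup>2"
          using second[OF h, of u] second[OF h, of v] second[OF h, of "u + v"]
          by (simp add: algebra_simps)
        finally show "norm (blinfun_apply (B (u + v) - (B u + B v)) h)
          \<le> (C * norm u + C * norm v + C * norm (u + v)) * (norm h)\<^sup>2" .
      qed (use R in simp)
      then show ?thesis by simp
    qed
    have B_scale: "B (c *\<^sub>C v) = c *\<^sub>C B v" for c v
    proof -
      have "B (c *\<^sub>C v) - c *\<^sub>C B v = 0"
      proof (rule blinfun_eq_0_if_quadratic)
        fix h :: 'a assume h: "norm h \<le> R / 2"
        let ?E = "\<lambda>v. ?D (z + h) v - ?D z v - blinfun_apply (B v) h"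
        have "dist z (z + h) < 3 * R"
          using h R by (simp add: dist_norm)
        then have "z + h \<in> S"
          using RS by auto
        then have "blinfun_apply (B (c *\<^sub>C v) - c *\<^sub>C B v) h = c *\<^sub>C ?E v - ?E (c *\<^sub>C v)"
          using z by (simp add: blinfun.diff_left scaleC.diff_right deriv(2))
        also have "norm \<dots> \<le> cmod c * norm (?E v) + norm (?E (c *\<^sub>C v))"
          using norm_triangle_ineq4[of "c *\<^sub>C ?E v" "?E (c *\<^sub>C v)"] by (simp add: norm_scaleC)
        also have "\<dots> \<le> cmod c * (C * norm v * (norm h)\<^sup>2) + C * norm (c *\<^sub>C v) * (norm h)\<^sup>2"
          by (intro add_mono mult_left_mono second[OF h]) simp
        finally show "norm (blinfun_apply (B (c *\<^sub>C v) - c *\<^sub>C B v) h)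
          \<le> (cmod c * C * norm v + C * norm (c *\<^sub>C v)) * (norm h)\<^sup>2"
          by (simp add: algebra_simps)
      qed (use R in simp)
      then show ?thesis by simp
    qed
    have B_real: "B (r *\<^sub>R v) = r *\<^sub>R B v" for r v
      by (simp add: B_scale flip: scaleC_of_real)
    have "\<exists>L. \<forall>v. norm (B v) \<le> norm v * L"
    proof (intro exI allI)
      fix v
      show "norm (B v) \<le> norm v * (4 / R * (K / R * (R / 4)\<^sup>2 + 4 * M / R))"
      proof (cases "v = 0")
        case True
        then show ?thesis using B_real[of 0 0] by simp
      next
        case False
        define u where "u = (R / 4 / norm v) *\<^sub>R v"
        have u: "norm u = R / 4"
          using False R by (simp add: u_def)
        then have "z + u \<in> ball z (2 * R)" "z \<in> ball z (2 * R)"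
          using R by (auto simp: dist_norm)
        then have "norm (fderiv F (z + u)) \<le> 2 * M / R" "norm (fderiv F z) \<le> 2 * M / R"
          by (auto intro: est)
        moreover have "norm (B u) \<le> norm (fderiv F (z + u) - fderiv F z - B u)
            + norm (fderiv F (z + u)) + norm (fderiv F z)"
          by norm
        ultimately have "norm (B u) \<le> K / R * (R / 4)\<^sup>2 + 4 * M / R"
          using remainder[of u] u by simp
        moreover have "norm (B v) = norm v * (4 / R * norm (B u))"
          using False R by (simp add: u_def B_real)
        ultimately show ?thesis
          using R by (simp add: mult_left_mono divide_right_mono)
      qed
    qed
    then have lin: "bounded_linear B"
      using B_add B_real by (auto intro: bounded_linear_intro)
    have "((\<lambda>y. (1 / norm (y - z)) *\<^sub>R (fderiv F y - (fderiv F z + B (y - z)))) \<longlongrightarrow> 0) (at z)"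
    proof (rule Lim_null_comparison)
      have "\<forall>\<^sub>F y in at z. dist y z < R / 4"
        using R by (auto simp: eventually_at intro!: exI[of _ "R / 4"])
      then show "\<forall>\<^sub>F y in at z. norm ((1 / norm (y - z)) *\<^sub>R (fderiv F y - (fderiv F z + B (y - z))))
          \<le> K / R * norm (y - z)"
      proof eventually_elim
        fix y assume "dist y z < R / 4"
        then have "norm (fderiv F y - fderiv F z - B (y - z)) \<le> K / R * (norm (y - z))\<^sup>2"
          using remainder[of "y - z"] by (simp add: dist_norm)
        then show "norm ((1 / norm (y - z)) *\<^sub>R (fderiv F y - (fderiv F z + B (y - z))))
          \<le> K / R * norm (y - z)"
          by (cases "y = z") (simp_all add: diff_diff_eq divide_le_eq power2_eq_square mult.assoc)
      qed
      have "((\<lambda>y. K / R * norm (y - z)) \<longlongrightarrow> K / R * norm (z - z)) (at z)"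
        by (intro tendsto_intros)
      then show "((\<lambda>y. K / R * norm (y - z)) \<longlongrightarrow> 0) (at z)"
        by simp
    qed
    then have "(fderiv F has_derivative B) (at z)"
      using lin by (simp add: has_derivative_at2)
    with B_scale show ?thesis by blast
  qed
  then obtain B where "\<And>z. z \<in> S \<Longrightarrow> (fderiv F has_derivative B z) (at z)"
    "\<And>z c v. z \<in> S \<Longrightarrow> B z (c *\<^sub>C v) = c *\<^sub>C B z v"
    by metis
  then show ?thesis by (rule frechet_holomorphic_onI)
qed

section \<open>Moments of probability measures on the circle\<close>

text \<open>Let \<open>g = x - c1\<close> and \<open>h = x\<^sup>2 - c2\<close> be the centred first and second powers of a random point of the
  unit circle. Then \<open>c4 - c2\<^sup>2\<close> is the mean of \<open>h\<^sup>2\<close>, \<open>c3 - c1 c2\<close> is the mean of \<open>g h\<close>, and the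
  variances of \<open>g\<close> and \<open>h\<close> are \<open>1 - r\<^sup>2\<close> and \<open>1 - s\<^sup>2\<close> with \<open>r = \<bar>c1\<bar>\<close> and \<open>s = \<bar>c2\<bar>\<close>. The expression
  is rewritten as
  \<open>- (c4 - c2\<^sup>2) / 2 - 4/3 c1 (c3 - c1 c2) + 2/3 c1\<^sup>2 c2 + 10/3 c1\<^sup>4\<close>.
  The first two terms measure how far the point is from being constant, and the last two are
  maximal when it is constant. The balance is settled by \<open>1 - s\<^sup>2 \<le> (2 + 2 r\<^sup>2) (1 - r\<^sup>2)\<close>: the second
  power of a nearly constant point is itself nearly constant. Equality occurs exactly at \<open>r = 1\<close>.\<close>

lemma zalcman_moment_bound:
  fixes w :: "real \<Rightarrow> real" and x :: "real \<Rightarrow> complex" and c1 c2 c3 c4 :: complex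
  assumes w: "(w has_integral 1) {0..1}" and w0: "\<And>t. t \<in> {0..1} \<Longrightarrow> w t \<ge> 0"
    and x: "\<And>t. cmod (x t) = 1"
    and c1: "((\<lambda>t. w t *\<^sub>R x t) has_integral c1) {0..1}"
    and c2: "((\<lambda>t. w t *\<^sub>R x t ^ 2) has_integral c2) {0..1}"
    and c3: "((\<lambda>t. w t *\<^sub>R x t ^ 3) has_integral c3) {0..1}"
    and c4: "((\<lambda>t. w t *\<^sub>R x t ^ 4) has_integral c4) {0..1}"
  shows "cmod (10 / 3 * c1 ^ 4 + 2 * c1\<^sup>2 * c2 + c2\<^sup>2 / 2 - c4 / 2 - 4 / 3 * c1 * c3) \<le> 4"
proof -
  have variance: "((\<lambda>t. w t * (cmod (y t - a))\<^sup>2) has_integral 1 + (cmod a)\<^sup>2 - 2 * Re (cnj a * m)) {0..1}"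
    if m: "((\<lambda>t. w t *\<^sub>R y t) has_integral m) {0..1}" and y: "\<And>t. cmod (y t) = 1"
    for y :: "real \<Rightarrow> complex" and a m
  proof -
    have "((\<lambda>t. Re (cnj a * (w t *\<^sub>R y t))) has_integral Re (cnj a * m)) {0..1}"
      using has_integral_linear[OF m bounded_linear_compose[OF bounded_linear_Re
            bounded_linear_mult_right[of "cnj a"]]] by (simp only: o_def)
    from has_integral_diff[OF has_integral_mult_left[OF w, of "1 + (cmod a)\<^sup>2"]
        has_integral_mult_right[OF this, of 2]]
    have "((\<lambda>t. w t * (1 + (cmod a)\<^sup>2) - 2 * Re (cnj a * (w t *\<^sub>R y t))) has_integral
        1 + (cmod a)\<^sup>2 - 2 * Re (cnj a * m)) {0..1}"
      by simp
    moreover have "w t * (cmod (y t - a))\<^sup>2 = w t * (1 + (cmod a)\<^sup>2) - 2 * Re (cnj a * (w t *\<^sub>R y t))" for t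
    proof -
      have "(cmod (y t - a))\<^sup>2 = (cmod (y t))\<^sup>2 + (cmod a)\<^sup>2 - 2 * Re (cnj a * y t)"
        unfolding cmod_power2 by (simp add: power2_eq_square algebra_simps)
      then have eq: "(cmod (y t - a))\<^sup>2 = 1 + (cmod a)\<^sup>2 - 2 * Re (cnj a * y t)"
        by (simp add: y)
      show ?thesis unfolding eq by (simp add: algebra_simps)
    qed
    ultimately show ?thesis by simp
  qed
  have x2: "cmod ((x t)\<^sup>2) = 1" for t
    by (simp add: x norm_power)
  define r s where "r = cmod c1" and "s = cmod c2"
  have rs: "r \<ge> 0" "s \<ge> 0" by (simp_all add: r_def s_def)
  have Re_cnj: "Re (cnj z * z) = (cmod z)\<^sup>2" for z
    unfolding cmod_power2 by (simp add: power2_eq_square)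
  have G: "((\<lambda>t. w t * (cmod (x t - c1))\<^sup>2) has_integral 1 - r\<^sup>2) {0..1}"
    using variance[OF c1 x, of c1] unfolding Re_cnj r_def by simp
  have H: "((\<lambda>t. w t * (cmod ((x t)\<^sup>2 - c2))\<^sup>2) has_integral 1 - s\<^sup>2) {0..1}"
    using variance[OF c2 x2, of c2] unfolding Re_cnj s_def by simp
  have "1 - r\<^sup>2 \<ge> 0"
    by (rule has_integral_nonneg[OF G]) (simp add: w0)
  then have r1: "r \<le> 1" using rs by (simp add: abs_square_le_1)
  have "1 - s\<^sup>2 \<ge> 0"
    by (rule has_integral_nonneg[OF H]) (simp add: w0)
  then have s1: "s \<le> 1" using rs by (simp add: abs_square_le_1)

  \<comment> \<open>The mean square of \<open>x\<^sup>2 - a\<close> is smallest at \<open>a = c2\<close>; the choice \<open>a = c1\<^sup>2\<close> factors through \<open>x - c1\<close>.\<close>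
  have H_le: "1 - s\<^sup>2 \<le> (2 + 2 * r\<^sup>2) * (1 - r\<^sup>2)"
  proof -
    have sq: "(cmod (c2 - c1\<^sup>2))\<^sup>2 = s\<^sup>2 + (cmod (c1\<^sup>2))\<^sup>2 - 2 * Re (cnj (c1\<^sup>2) * c2)"
      unfolding s_def cmod_power2 by (simp add: power2_eq_square algebra_simps)
    have "1 - s\<^sup>2 \<le> 1 + (cmod (c1\<^sup>2))\<^sup>2 - 2 * Re (cnj (c1\<^sup>2) * c2)"
      using sq zero_le_power2[of "cmod (c2 - c1\<^sup>2)"] by linarith
    also have "\<dots> \<le> (2 + 2 * r\<^sup>2) * (1 - r\<^sup>2)"
    proof (rule has_integral_le[OF variance[OF c2 x2] has_integral_mult_right[OF G]])
      fix t :: real assume t: "t \<in> {0..1}"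
      have "(cmod (x t + c1))\<^sup>2 + (cmod (x t - c1))\<^sup>2 = 2 * (cmod (x t))\<^sup>2 + 2 * r\<^sup>2"
        unfolding r_def cmod_power2 by (simp add: power2_eq_square algebra_simps)
      then have "(cmod (x t + c1))\<^sup>2 \<le> 2 + 2 * r\<^sup>2"
        using zero_le_power2[of "cmod (x t - c1)"] unfolding x power_one by linarith
      then have "(w t * (cmod (x t - c1))\<^sup>2) * (cmod (x t + c1))\<^sup>2
          \<le> (w t * (cmod (x t - c1))\<^sup>2) * (2 + 2 * r\<^sup>2)"
        using w0[OF t] by (intro mult_left_mono) auto
      moreover have "(x t)\<^sup>2 - c1\<^sup>2 = (x t - c1) * (x t + c1)"
        by (simp add: power2_eq_square algebra_simps)
      ultimately show "w t * (cmod ((x t)\<^sup>2 - c1\<^sup>2))\<^sup>2 \<le> (2 + 2 * r\<^sup>2) * (w t * (cmod (x t - c1))\<^sup>2)"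
        by (simp add: norm_mult power_mult_distrib mult_ac)
    qed
    finally show ?thesis .
  qed

  have main: "cmod (- (c4 - c2\<^sup>2) / 2 - 4 / 3 * c1 * (c3 - c1 * c2))
      \<le> 5 / 6 * (1 - s\<^sup>2) + 4 / 3 * r\<^sup>2 * (1 - r\<^sup>2)"
  proof -
    define q where "q t = ((x t)\<^sup>2 - c2) * (- ((x t)\<^sup>2 - c2) / 2 - 4 / 3 * c1 * (x t - c1))" for t
    have "((\<lambda>t. (w t *\<^sub>R x t ^ 4) * (- 1 / 2) + (w t *\<^sub>R x t ^ 3) * (- 4 / 3 * c1)
        + (w t *\<^sub>R (x t)\<^sup>2) * (c2 + 4 / 3 * c1\<^sup>2) + (w t *\<^sub>R x t) * (4 / 3 * c1 * c2)
        + w t *\<^sub>R (- (c2\<^sup>2) / 2 - 4 / 3 * c1\<^sup>2 * c2)) has_integral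
        c4 * (- 1 / 2) + c3 * (- 4 / 3 * c1) + c2 * (c2 + 4 / 3 * c1\<^sup>2) + c1 * (4 / 3 * c1 * c2)
        + 1 *\<^sub>R (- (c2\<^sup>2) / 2 - 4 / 3 * c1\<^sup>2 * c2)) {0..1}"
      by (intro has_integral_add has_integral_mult_left has_integral_scaleR_left c1 c2 c3 c4 w)
    moreover have "(w t *\<^sub>R x t ^ 4) * (- 1 / 2) + (w t *\<^sub>R x t ^ 3) * (- 4 / 3 * c1)
        + (w t *\<^sub>R (x t)\<^sup>2) * (c2 + 4 / 3 * c1\<^sup>2) + (w t *\<^sub>R x t) * (4 / 3 * c1 * c2)
        + w t *\<^sub>R (- (c2\<^sup>2) / 2 - 4 / 3 * c1\<^sup>2 * c2) = w t *\<^sub>R q t" for t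
      unfolding q_def scaleR_conv_of_real by (simp add: field_simps power2_eq_square power3_eq_cube power4_eq_xxxx)
    moreover have "c4 * (- 1 / 2) + c3 * (- 4 / 3 * c1) + c2 * (c2 + 4 / 3 * c1\<^sup>2) + c1 * (4 / 3 * c1 * c2)
        + 1 *\<^sub>R (- (c2\<^sup>2) / 2 - 4 / 3 * c1\<^sup>2 * c2) = - (c4 - c2\<^sup>2) / 2 - 4 / 3 * c1 * (c3 - c1 * c2)"
      by (simp add: field_simps power2_eq_square)
    ultimately have q: "((\<lambda>t. w t *\<^sub>R q t) has_integral
        - (c4 - c2\<^sup>2) / 2 - 4 / 3 * c1 * (c3 - c1 * c2)) {0..1}"
      by simp
    have b: "((\<lambda>t. 5 / 6 * (w t * (cmod ((x t)\<^sup>2 - c2))\<^sup>2) + 4 / 3 * r\<^sup>2 * (w t * (cmod (x t - c1))\<^sup>2))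
        has_integral 5 / 6 * (1 - s\<^sup>2) + 4 / 3 * r\<^sup>2 * (1 - r\<^sup>2)) {0..1}"
      by (intro has_integral_add has_integral_mult_right G H)
    have "norm (integral {0..1} (\<lambda>t. w t *\<^sub>R q t)) \<le> integral {0..1}
        (\<lambda>t. 5 / 6 * (w t * (cmod ((x t)\<^sup>2 - c2))\<^sup>2) + 4 / 3 * r\<^sup>2 * (w t * (cmod (x t - c1))\<^sup>2))"
    proof (rule Henstock_Kurzweil_Integration.integral_norm_bound_integral)
      fix t :: real assume t: "t \<in> {0..1}"
      define g h where "g = cmod (x t - c1)" and "h = cmod ((x t)\<^sup>2 - c2)"
      have "cmod (- ((x t)\<^sup>2 - c2) / 2 - 4 / 3 * c1 * (x t - c1))
          \<le> cmod (- ((x t)\<^sup>2 - c2) / 2) + cmod (4 / 3 * c1 * (x t - c1))"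
        by (rule norm_triangle_ineq4)
      also have "\<dots> = h / 2 + 4 / 3 * r * g"
        by (simp add: norm_mult norm_divide g_def h_def r_def norm_minus_commute)
      finally have "cmod (q t) \<le> h * (h / 2 + 4 / 3 * r * g)"
        unfolding q_def norm_mult by (simp add: h_def mult_left_mono)
      \<comment> \<open>The weights of \<open>r g h \<le> r\<^sup>2 g\<^sup>2 + h\<^sup>2 / 4\<close> are those of equality when \<open>h = 2 r g\<close>, as near a constant point of the circle.\<close>
      also have "\<dots> \<le> 5 / 6 * h\<^sup>2 + 4 / 3 * r\<^sup>2 * g\<^sup>2"
        using zero_le_power2[of "h - 2 * (r * g)"] by (simp add: power2_eq_square algebra_simps)
      finally have "w t * cmod (q t) \<le> w t * (5 / 6 * h\<^sup>2 + 4 / 3 * r\<^sup>2 * g\<^sup>2)"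
        using w0[OF t] by (rule mult_left_mono)
      then show "norm (w t *\<^sub>R q t)
          \<le> 5 / 6 * (w t * (cmod ((x t)\<^sup>2 - c2))\<^sup>2) + 4 / 3 * r\<^sup>2 * (w t * (cmod (x t - c1))\<^sup>2)"
        using w0[OF t] by (simp add: g_def h_def algebra_simps)
    qed (use q b in \<open>auto simp: has_integral_integrable\<close>)
    then show ?thesis
      using integral_unique[OF q] integral_unique[OF b] by simp
  qed

  have "10 / 3 * c1 ^ 4 + 2 * c1\<^sup>2 * c2 + c2\<^sup>2 / 2 - c4 / 2 - 4 / 3 * c1 * c3
      = (- (c4 - c2\<^sup>2) / 2 - 4 / 3 * c1 * (c3 - c1 * c2)) + 2 / 3 * c1\<^sup>2 * c2 + 10 / 3 * c1 ^ 4"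
    by (simp add: field_simps power2_eq_square)
  also have "cmod \<dots> \<le> cmod (- (c4 - c2\<^sup>2) / 2 - 4 / 3 * c1 * (c3 - c1 * c2))
      + cmod (2 / 3 * c1\<^sup>2 * c2) + cmod (10 / 3 * c1 ^ 4)"
    by norm
  also have "cmod (2 / 3 * c1\<^sup>2 * c2) = 2 / 3 * r\<^sup>2 * s"
    by (simp add: norm_mult norm_divide norm_power r_def s_def)
  also have "cmod (10 / 3 * c1 ^ 4) = 10 / 3 * r ^ 4"
    by (simp add: norm_mult norm_divide norm_power r_def)
  also have "cmod (- (c4 - c2\<^sup>2) / 2 - 4 / 3 * c1 * (c3 - c1 * c2)) + 2 / 3 * r\<^sup>2 * s + 10 / 3 * r ^ 4
      \<le> (5 / 6 * ((2 + 2 * r\<^sup>2) * (1 - r\<^sup>2)) + 4 / 3 * r\<^sup>2 * (1 - r\<^sup>2)) + 2 / 3 * r\<^sup>2 * 1 + 10 / 3 * r ^ 4"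
    using H_le s1 by (intro add_mono mult_left_mono order_trans[OF main]) auto
  also have "\<dots> = 5 / 3 + 2 * r\<^sup>2 + 1 / 3 * r ^ 4"
    by (simp add: field_simps power2_eq_square power4_eq_xxxx)
  also have "\<dots> \<le> 5 / 3 + 2 * 1 + 1 / 3 * 1"
    using r1 rs by (intro add_mono mult_left_mono power_le_one) auto
  finally show ?thesis by simp
qed

section \<open>Functions with positive real part and starlike functions\<close>

lemma circle_moments:
  assumes p: "p holomorphic_on ball 0 1" and \<rho>: "0 < \<rho>" "\<rho> < 1"
  defines "u \<equiv> \<lambda>t. of_real \<rho> * exp (2 * of_real pi * \<i> * of_real t)"
  shows "((\<lambda>t. p (u t) * exp (- (2 * of_real pi * \<i> * of_real t)) ^ k) has_integral
          (deriv ^^ k) p 0 / fact k * of_real \<rho> ^ k) {0..1}"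
proof -
  have sub: "cball 0 \<rho> \<subseteq> ball (0::complex) 1" "ball 0 \<rho> \<subseteq> ball (0::complex) 1"
    using \<rho> by auto
  have "((\<lambda>z. p z / (z - 0) ^ Suc k) has_contour_integral
      (2 * pi * \<i>) / fact k * (deriv ^^ k) p 0) (circlepath 0 \<rho>)"
    using \<rho> by (intro Cauchy_has_contour_integral_higher_derivative_circlepath
        holomorphic_on_imp_continuous_on holomorphic_on_subset[OF p] sub) auto
  then have "((\<lambda>t. p (u t) / u t ^ Suc k * (2 * pi * \<i> * u t)) has_integral
      (2 * pi * \<i>) / fact k * (deriv ^^ k) p 0) {0..1}"
    unfolding has_contour_integral_def
  proof (rule has_integral_eq[rotated])
    fix t :: real assume t: "t \<in> {0..1}"
    have "circlepath 0 \<rho> t = u t"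
      by (simp add: circlepath u_def)
    moreover have "vector_derivative (circlepath 0 \<rho>) (at t within {0..1}) = 2 * pi * \<i> * u t"
      using t by (simp add: vector_derivative_circlepath01 u_def)
    ultimately show "p (circlepath 0 \<rho> t) / (circlepath 0 \<rho> t - 0) ^ Suc k *
        vector_derivative (circlepath 0 \<rho>) (at t within {0..1}) = p (u t) / u t ^ Suc k * (2 * pi * \<i> * u t)"
      by simp
  qed
  then have "((\<lambda>t. p (u t) / u t ^ Suc k * (2 * pi * \<i> * u t) * (of_real \<rho> ^ k / (2 * pi * \<i>))) has_integral
      (2 * pi * \<i>) / fact k * (deriv ^^ k) p 0 * (of_real \<rho> ^ k / (2 * pi * \<i>))) {0..1}"
    by (rule has_integral_mult_left)
  moreover have "p (u t) / u t ^ Suc k * (2 * pi * \<i> * u t) * (of_real \<rho> ^ k / (2 * pi * \<i>))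
      = p (u t) * exp (- (2 * of_real pi * \<i> * of_real t)) ^ k" for t
    using \<rho> by (simp add: u_def exp_minus power_mult_distrib field_simps)
  ultimately show ?thesis by simp
qed

text \<open>The conjugate of \<open>p\<close> has only frequencies of nonpositive sign, so passing to the real part halves
  the moments of positive order. For \<open>Re p > 0\<close> and \<open>p 0 = 1\<close> this exhibits half the Taylor
  coefficients, scaled by powers of \<open>\<rho>\<close>, as moments of a probability density on the circle.\<close>

lemma circle_moments_Re:
  assumes p: "p holomorphic_on ball 0 1" and \<rho>: "0 < \<rho>" "\<rho> < 1" and k: "k > 0"
  defines "u \<equiv> \<lambda>t. of_real \<rho> * exp (2 * of_real pi * \<i> * of_real t)"
    and "x \<equiv> \<lambda>t. exp (- (2 * of_real pi * \<i> * of_real t))"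
  shows "((\<lambda>t. Re (p (u t)) *\<^sub>R x t ^ k) has_integral
          (deriv ^^ k) p 0 / fact k * of_real \<rho> ^ k / 2) {0..1}"
proof -
  have "(\<lambda>z. p z * z ^ k) holomorphic_on ball 0 1"
    by (intro holomorphic_intros p)
  from circle_moments[OF this \<rho>, of 0]
  have "((\<lambda>t. p (u t) * u t ^ k) has_integral 0) {0..1}"
    using k by (simp only: u_def) (simp add: power_0_left)
  from has_integral_linear[OF has_integral_mult_left[OF this, of "1 / of_real \<rho> ^ k"] bounded_linear_cnj]
  have "((\<lambda>t. cnj (p (u t) * u t ^ k * (1 / of_real \<rho> ^ k))) has_integral 0) {0..1}"
    by (simp add: o_def)
  moreover have "cnj (p (u t) * u t ^ k * (1 / of_real \<rho> ^ k)) = cnj (p (u t)) * x t ^ k" for t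
    using \<rho> by (simp add: u_def x_def power_mult_distrib exp_cnj)
  ultimately have "((\<lambda>t. cnj (p (u t)) * x t ^ k) has_integral 0) {0..1}"
    by simp
  moreover have "((\<lambda>t. p (u t) * x t ^ k) has_integral (deriv ^^ k) p 0 / fact k * of_real \<rho> ^ k) {0..1}"
    using circle_moments[OF p \<rho>] by (simp only: u_def x_def)
  ultimately have "((\<lambda>t. (p (u t) * x t ^ k + cnj (p (u t)) * x t ^ k) * (1 / 2)) has_integral
      ((deriv ^^ k) p 0 / fact k * of_real \<rho> ^ k + 0) * (1 / 2)) {0..1}"
    by (intro has_integral_mult_left has_integral_add)
  moreover have Re_eq: "(a * b + cnj a * b) * (1 / 2) = Re a *\<^sub>R b" for a b
    by (simp add: complex_eq_iff field_simps)
  ultimately show ?thesis unfolding Re_eq by simp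
qed

text \<open>All terms have weight \<open>4\<close> when \<open>c k\<close> has weight \<open>k\<close>. Hence the moment bound on the circle of radius
  \<open>\<rho>\<close> is the assertion with the factor \<open>\<rho>\<^sup>4\<close>, and \<open>\<rho>\<close> tends to \<open>1\<close>.\<close>

lemma caratheodory_bound:
  fixes p :: "complex \<Rightarrow> complex"
  assumes p: "p holomorphic_on ball 0 1" and p0: "p 0 = 1"
    and pos: "\<And>z. z \<in> ball 0 1 \<Longrightarrow> Re (p z) > 0"
  defines "c \<equiv> \<lambda>k. (deriv ^^ k) p 0 / fact k / 2"
  shows "cmod (10 / 3 * c 1 ^ 4 + 2 * (c 1)\<^sup>2 * c 2 + (c 2)\<^sup>2 / 2 - c 4 / 2 - 4 / 3 * c 1 * c 3) \<le> 4"
    (is "cmod ?E \<le> 4")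
proof -
  have scaled: "\<rho> ^ 4 * cmod ?E \<le> 4" if \<rho>: "0 < \<rho>" "\<rho> < 1" for \<rho> :: real
  proof -
    define u where "u t = of_real \<rho> * exp (2 * of_real pi * \<i> * of_real t)" for t :: real
    define x where "x t = exp (- (2 * of_real pi * \<i> * of_real t))" for t :: real
    have u: "u t \<in> ball 0 1" for t
      using \<rho> by (simp add: u_def norm_mult)
    have m: "((\<lambda>t. Re (p (u t)) *\<^sub>R x t ^ k) has_integral of_real \<rho> ^ k * c k) {0..1}" if "k > 0" for k
      using circle_moments_Re[OF p \<rho> that] by (simp add: u_def x_def c_def mult.commute)
    have w: "((\<lambda>t. Re (p (u t))) has_integral 1) {0..1}"
      using has_integral_linear[OF circle_moments[OF p \<rho>, of 0] bounded_linear_Re]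
      by (simp add: o_def u_def p0)
    have "cmod (10 / 3 * (of_real \<rho> ^ 1 * c 1) ^ 4
        + 2 * (of_real \<rho> ^ 1 * c 1)\<^sup>2 * (of_real \<rho> ^ 2 * c 2)
        + (of_real \<rho> ^ 2 * c 2)\<^sup>2 / 2 - (of_real \<rho> ^ 4 * c 4) / 2
        - 4 / 3 * (of_real \<rho> ^ 1 * c 1) * (of_real \<rho> ^ 3 * c 3)) \<le> 4"
      using m[of 1] m[of 2] m[of 3] m[of 4] pos[OF u]
      by (intro zalcman_moment_bound[OF w, of x]) (auto simp: x_def less_imp_le)
    also have "10 / 3 * (of_real \<rho> ^ 1 * c 1) ^ 4
        + 2 * (of_real \<rho> ^ 1 * c 1)\<^sup>2 * (of_real \<rho> ^ 2 * c 2)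
        + (of_real \<rho> ^ 2 * c 2)\<^sup>2 / 2 - (of_real \<rho> ^ 4 * c 4) / 2
        - 4 / 3 * (of_real \<rho> ^ 1 * c 1) * (of_real \<rho> ^ 3 * c 3) = of_real \<rho> ^ 4 * ?E"
      by (simp add: field_simps power2_eq_square power3_eq_cube power4_eq_xxxx)
    finally show ?thesis
      using \<rho> by (simp add: norm_mult norm_power)
  qed
  have "\<forall>\<^sub>F \<rho> in at_left (1::real). 0 < \<rho> \<and> \<rho> < 1"
    by (rule eventually_at_leftI[of 0]) auto
  then have "\<forall>\<^sub>F \<rho> in at_left (1::real). \<rho> ^ 4 * cmod ?E \<le> 4"
    by eventually_elim (use scaled in auto)
  moreover have "((\<lambda>\<rho>::real. \<rho> ^ 4 * cmod ?E) \<longlongrightarrow> 1 ^ 4 * cmod ?E) (at_left 1)"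
    by (intro tendsto_intros)
  ultimately have "1 ^ 4 * cmod ?E \<le> 4"
    by (intro tendsto_upperbound) auto
  then show ?thesis by simp
qed

text \<open>The function \<open>z g(z)\<close> is starlike because \<open>p = 1 + z g' / g\<close> is the quotient \<open>z \<phi>' / \<phi>\<close> for
  \<open>\<phi> = z g\<close>. Comparing coefficients in \<open>p g = g + z g'\<close> expresses the coefficients of \<open>g\<close> as
  polynomials in those of \<open>p\<close>.\<close>

lemma starlike_zalcman:
  fixes g :: "complex \<Rightarrow> complex"
  assumes g: "g holomorphic_on ball 0 1" and g0: "g 0 = 1"
    and nz: "\<And>z. z \<in> ball 0 1 \<Longrightarrow> g z \<noteq> 0"
    and pos: "\<And>z. z \<in> ball 0 1 \<Longrightarrow> Re (1 + z * deriv g z / g z) > 0"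
  shows "cmod ((fps_nth (fps_expansion g 0) 2)\<^sup>2 - fps_nth (fps_expansion g 0) 4) \<le> 4"
proof -
  define p where "p z = 1 + z * deriv g z / g z" for z
  define G P where "G = fps_expansion g 0" and "P = fps_expansion p 0"
  have p: "p holomorphic_on ball 0 1"
    unfolding p_def using nz by (intro holomorphic_intros g) auto
  have G: "g has_fps_expansion G" and P: "p has_fps_expansion P"
    unfolding G_def P_def using g p by (auto intro!: has_fps_expansion_fps_expansion[of "ball 0 1"])
  have "(\<lambda>z. g z + z * deriv g z) has_fps_expansion G + fps_X * fps_deriv G"
    by (intro fps_expansion_intros G)
  moreover have "\<forall>\<^sub>F z in nhds 0. p z * g z = g z + z * deriv g z"
  proof (rule eventually_nhds_in_open[of "ball 0 1" 0, THEN eventually_mono])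
    show "p z * g z = g z + z * deriv g z" if "z \<in> ball 0 1" for z
      using nz[OF that] by (simp add: p_def field_simps)
  qed auto
  ultimately have "(\<lambda>z. p z * g z) has_fps_expansion G + fps_X * fps_deriv G"
    by (simp cong: has_fps_expansion_cong)
  moreover have "(\<lambda>z. p z * g z) has_fps_expansion P * G"
    by (intro fps_expansion_intros G P)
  ultimately have eq: "P * G = G + fps_X * fps_deriv G"
    by (intro fps_expansion_unique_complex)
  have P0: "fps_nth P 0 = 1" and G0: "fps_nth G 0 = 1"
    by (simp_all add: P_def G_def fps_expansion_def p_def g0)
  have rec: "(\<Sum>i=0..n. fps_nth P i * fps_nth G (n - i)) = fps_nth G n + of_nat n * fps_nth G n" for n
  proof -
    have "fps_nth (P * G) n = fps_nth G n + of_nat n * fps_nth G n"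
      unfolding eq by (cases n) simp_all
    then show ?thesis by (simp only: fps_mult_nth)
  qed
  define c where "c k = fps_nth P k / 2" for k
  have Pc: "fps_nth P k = 2 * c k" for k
    by (simp add: c_def)
  have c0: "c 0 = 1 / 2"
    by (simp add: c_def P0)
  have G1: "fps_nth G 1 = 2 * c 1"
    using rec[of 1] by (simp add: c0 G0 Pc)
  have G2: "2 * fps_nth G 2 = 2 * c 2 + 2 * c 1 * fps_nth G 1"
    using rec[of 2] by (simp add: c0 G0 Pc G1 numeral_2_eq_2 field_simps)
  have G3: "3 * fps_nth G 3 = 2 * c 3 + 2 * c 2 * fps_nth G 1 + 2 * c 1 * fps_nth G 2"
    using rec[of 3] by (simp add: c0 G0 Pc numeral_3_eq_3 numeral_2_eq_2 field_simps)
  have G4: "4 * fps_nth G 4 = 2 * c 4 + 2 * c 3 * fps_nth G 1 + 2 * c 2 * fps_nth G 2 + 2 * c 1 * fps_nth G 3"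
    using rec[of 4] by (simp add: c0 G0 Pc eval_nat_numeral field_simps)
  have "12 * ((fps_nth G 2)\<^sup>2 - fps_nth G 4) = 12 * (10 / 3 * c 1 ^ 4 + 2 * (c 1)\<^sup>2 * c 2 + (c 2)\<^sup>2 / 2 - c 4 / 2 - 4 / 3 * c 1 * c 3)"
    using G1 G2 G3 G4 by algebra
  then have "(fps_nth G 2)\<^sup>2 - fps_nth G 4 = 10 / 3 * c 1 ^ 4 + 2 * (c 1)\<^sup>2 * c 2 + (c 2)\<^sup>2 / 2 - c 4 / 2 - 4 / 3 * c 1 * c 3"
    by (rule mult_left_cancel[THEN iffD1, rotated]) simp
  also have "cmod \<dots> \<le> 4"
    using caratheodory_bound[OF p] pos by (simp add: c_def P_def fps_expansion_def p_def[abs_def])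
  finally show ?thesis by (simp add: G_def)
qed

section \<open>Slices of mappings along complex lines\<close>

lemma bounded_clinear_blinfun_apply:
  assumes "bounded_clinear l"
  shows "bounded_clinear (\<lambda>A. l (blinfun_apply A u))"
proof (rule bounded_clinearI)
  have "bounded_linear l"
    using assms by (simp add: bounded_clinear_def)
  then show "bounded_linear (\<lambda>A. l (blinfun_apply A u))"
    by (rule bounded_linear_compose[OF _ blinfun.bounded_linear_left])
  show "l (blinfun_apply (c *\<^sub>C A) u) = c *\<^sub>C l (blinfun_apply A u)" for c A
    using assms by (simp add: bounded_clinear_def)
qed

lemma deriv_along_line:
  fixes F :: "'a::complex_normed_vector \<Rightarrow> 'b::complex_normed_vector"
  assumes F: "F frechet_holomorphic_on ball 0 1" and u: "norm u = 1" and l: "bounded_clinear l"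
    and \<zeta>: "\<zeta> \<in> ball 0 1"
  shows "((\<lambda>\<zeta>. l (F (\<zeta> *\<^sub>C u))) has_field_derivative
           l (blinfun_apply (fderiv F (\<zeta> *\<^sub>C u)) u)) (at \<zeta>)"
  using has_field_derivative_along_line[OF F open_ball _ l, of 0 \<zeta> u] u \<zeta>
  by (simp add: norm_scaleC)

text \<open>One differentiation of a slice is one application of \<open>fderiv\<close>, with evaluation at \<open>u\<close> absorbed into
  the functional. The functional changes in each step, and so does the target space of the map.\<close>

lemma higher_deriv_along_line_step:
  fixes F :: "'a::complex_normed_vector \<Rightarrow> 'b::complex_normed_vector"
  assumes F: "F frechet_holomorphic_on ball 0 1" and u: "norm u = 1" and l: "bounded_clinear l"
    and \<phi>: "\<And>\<zeta>. \<zeta> \<in> ball 0 1 \<Longrightarrow> (deriv ^^ n) \<phi> \<zeta> = l (F (\<zeta> *\<^sub>C u))"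
    and \<zeta>: "\<zeta> \<in> ball 0 1"
  shows "(deriv ^^ Suc n) \<phi> \<zeta> = l (blinfun_apply (fderiv F (\<zeta> *\<^sub>C u)) u)"
proof -
  have "\<forall>\<^sub>F \<zeta> in nhds \<zeta>. (deriv ^^ n) \<phi> \<zeta> = l (F (\<zeta> *\<^sub>C u))"
    using eventually_nhds_in_open[OF open_ball \<zeta>] by eventually_elim (rule \<phi>)
  then have "deriv ((deriv ^^ n) \<phi>) \<zeta> = deriv (\<lambda>\<zeta>. l (F (\<zeta> *\<^sub>C u))) \<zeta>"
    by (intro deriv_cong_ev refl)
  then show ?thesis
    using DERIV_imp_deriv[OF deriv_along_line[OF F u l \<zeta>]] by simp
qed

lemma D3_D5_along_line:
  fixes F :: "'a::complex_normed_vector \<Rightarrow> 'b::complex_banach"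
  assumes F: "F frechet_holomorphic_on ball 0 1" and u: "norm u = 1" and l: "bounded_clinear l"
  defines "\<phi> \<equiv> \<lambda>\<zeta>. l (F (\<zeta> *\<^sub>C u))"
  shows "l (D3 F 0 u u u) = (deriv ^^ 3) \<phi> 0" and "l (D5 F 0 u u u u u) = (deriv ^^ 5) \<phi> 0"
proof -
  note hol = frechet_holomorphic_on_fderiv[OF _ open_ball]
  note lin = bounded_clinear_blinfun_apply[of _ u]
  note F1 = hol[OF F] note F2 = hol[OF F1] note F3 = hol[OF F2] note F4 = hol[OF F3]
  note l1 = lin[OF l] note l2 = lin[OF l1] note l3 = lin[OF l2] note l4 = lin[OF l3]
  have d0: "(deriv ^^ 0) \<phi> \<zeta> = l (F (\<zeta> *\<^sub>C u))" for \<zeta>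
    by (simp add: \<phi>_def)
  note d1 = higher_deriv_along_line_step[OF F u l d0]
  note d2 = higher_deriv_along_line_step[OF F1 u l1 d1]
  note d3 = higher_deriv_along_line_step[OF F2 u l2 d2]
  note d4 = higher_deriv_along_line_step[OF F3 u l3 d3]
  note d5 = higher_deriv_along_line_step[OF F4 u l4 d4]
  show "l (D3 F 0 u u u) = (deriv ^^ 3) \<phi> 0"
    using d3[of 0] by (simp add: D3_def numeral_3_eq_3)
  show "l (D5 F 0 u u u u u) = (deriv ^^ 5) \<phi> 0"
    using d5[of 0] by (simp add: D5_def eval_nat_numeral)
qed

lemma D3_scaleR: "D3 F a (r *\<^sub>R u) (r *\<^sub>R u) (r *\<^sub>R u) = r ^ 3 *\<^sub>R D3 F a u u u"
  by (simp add: D3_def blinfun.scaleR_left blinfun.scaleR_right power3_eq_cube)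

lemma D5_scaleR: "D5 F a (r *\<^sub>R u) (r *\<^sub>R u) (r *\<^sub>R u) (r *\<^sub>R u) (r *\<^sub>R u)
    = r ^ 5 *\<^sub>R D5 F a u u u u u"
  by (simp add: D5_def blinfun.scaleR_left blinfun.scaleR_right eval_nat_numeral)

text \<open>The starlikeness condition at all points of the complex line through \<open>u\<close> can be tested with
  rotations of a single functional.\<close>

lemma support_functionals_rotate:
  assumes l: "l \<in> support_functionals u" and u: "norm u = 1" and \<zeta>: "\<zeta> \<noteq> 0"
  shows "(\<lambda>x. cnj \<zeta> / cmod \<zeta> * l x) \<in> support_functionals (\<zeta> *\<^sub>C u)"
proof -
  have l': "bounded_clinear l" "bounded_linear l" "l u = 1" "onorm l = 1"
    using l u by (simp_all add: support_functionals_def bounded_clinear_def)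
  let ?m = "\<lambda>x. cnj \<zeta> / cmod \<zeta> * l x"
  have "bounded_linear ?m"
    by (rule bounded_linear_compose[OF bounded_linear_mult_right l'(2)])
  then have "bounded_clinear ?m"
    by (rule bounded_clinearI)
      (simp add: bounded_clinear_functional_scaleC[OF l'(1)] scaleC_complex_def)
  moreover have "?m (\<zeta> *\<^sub>C u) = of_real (norm (\<zeta> *\<^sub>C u))"
    using \<zeta> by (simp add: bounded_clinear_functional_scaleC[OF l'(1)] l' norm_scaleC u
        divide_simps power2_eq_square flip: complex_norm_square of_real_mult)
      (simp add: complex_norm_square[symmetric] power2_eq_square mult.commute)
  moreover have "onorm ?m = 1"
    using \<zeta> l'(4) by (simp add: onorm_def norm_mult norm_divide)
  ultimately show ?thesis
    by (simp add: support_functionals_def)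
qed

lemma scaled_identity_derivative:
  fixes f :: "'a::complex_normed_vector \<Rightarrow> complex"
  assumes f: "f frechet_holomorphic_on S" and S: "open S" "z \<in> S"
  defines "F \<equiv> \<lambda>z. f z *\<^sub>C z"
  shows "(F has_derivative (\<lambda>h. f z *\<^sub>C h + blinfun_apply (fderiv f z) h *\<^sub>C z)) (at z)"
    and "blinfun_apply (fderiv F z) h = f z *\<^sub>C h + blinfun_apply (fderiv f z) h *\<^sub>C z"
proof -
  show d: "(F has_derivative (\<lambda>h. f z *\<^sub>C h + blinfun_apply (fderiv f z) h *\<^sub>C z)) (at z)"
    unfolding F_def
    using scaleC.FDERIV[OF frechet_holomorphic_onD(1)[OF f S] has_derivative_ident] by simp
  then have A: "blinfun_apply (Blinfun (\<lambda>h. f z *\<^sub>C h + blinfun_apply (fderiv f z) h *\<^sub>C z))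
      = (\<lambda>h. f z *\<^sub>C h + blinfun_apply (fderiv f z) h *\<^sub>C z)"
    by (intro bounded_linear_Blinfun_apply has_derivative_bounded_linear)
  have "fderiv F z = Blinfun (\<lambda>h. f z *\<^sub>C h + blinfun_apply (fderiv f z) h *\<^sub>C z)"
    by (rule fderiv_eqI) (simp only: A d)
  then show "blinfun_apply (fderiv F z) h = f z *\<^sub>C h + blinfun_apply (fderiv f z) h *\<^sub>C z"
    by (simp only: A)
qed

lemma frechet_holomorphic_on_scaled_identity:
  fixes f :: "'a::complex_normed_vector \<Rightarrow> complex"
  assumes f: "f frechet_holomorphic_on S" and S: "open S"
  shows "(\<lambda>z. f z *\<^sub>C z) frechet_holomorphic_on S"
  using scaled_identity_derivative(1)[OF f S]
proof (rule frechet_holomorphic_onI)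
  show "f z *\<^sub>C c *\<^sub>C v + blinfun_apply (fderiv f z) (c *\<^sub>C v) *\<^sub>C z
      = c *\<^sub>C (f z *\<^sub>C v + blinfun_apply (fderiv f z) v *\<^sub>C z)" if "z \<in> S" for z c v
    using frechet_holomorphic_onD(2)[OF f S that]
    by (simp add: scaleC.add_right scaleC_scaleC mult.commute scaleC_complex_def)
qed

text \<open>On the line through a unit vector \<open>u\<close> with \<open>l u = 1\<close>, the functional \<open>l\<close> turns the mapping
  \<open>f(z) z\<close> into \<open>\<zeta> g(\<zeta>)\<close>, where \<open>g\<close> is the restriction of \<open>f\<close>; the factor \<open>\<zeta>\<close> shifts the coefficients
  by one.\<close>

lemma slice_coefficients:
  fixes f :: "'a::complex_banach \<Rightarrow> complex"
  assumes f: "f frechet_holomorphic_on ball 0 1" and z: "z \<noteq> 0"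
    and l: "l \<in> support_functionals z"
  defines "F \<equiv> \<lambda>z. f z *\<^sub>C z" and "g \<equiv> \<lambda>\<zeta>. f (\<zeta> *\<^sub>C (1 / norm z) *\<^sub>R z)"
  shows "l (D3 F 0 z z z) / of_real (fact 3 * norm z ^ 3) = fps_nth (fps_expansion g 0) 2"
    and "l (D5 F 0 z z z z z) / of_real (fact 5 * norm z ^ 5) = fps_nth (fps_expansion g 0) 4"
proof -
  define u where "u = (1 / norm z) *\<^sub>R z"
  have u: "norm u = 1" "z = norm z *\<^sub>R u"
    using z by (simp_all add: u_def)
  have l': "bounded_clinear l" "bounded_linear l" "l z = norm z"
    using l by (simp_all add: support_functionals_def bounded_clinear_def)
  have lR: "l (r *\<^sub>R x) = of_real r * l x" for r x
    using l'(2) by (simp add: linear_scale bounded_linear.linear scaleR_conv_of_real)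
  have lu: "l u = 1"
    using l'(3) z by (simp add: u_def lR)
  have F: "F frechet_holomorphic_on ball 0 1"
    unfolding F_def using f by (rule frechet_holomorphic_on_scaled_identity) simp
  have "g holomorphic_on ball 0 1"
  proof (rule holomorphic_onI)
    fix \<zeta> :: complex assume "\<zeta> \<in> ball 0 1"
    moreover have "bounded_clinear (\<lambda>c::complex. c)"
      by (simp add: bounded_clinear_def bounded_linear_ident)
    ultimately have "(g has_field_derivative blinfun_apply (fderiv f (\<zeta> *\<^sub>C u)) u) (at \<zeta>)"
      unfolding g_def u_def[symmetric] using deriv_along_line[OF f u(1)] by blast
    then show "g field_differentiable at \<zeta> within ball 0 1"
      by (auto simp: field_differentiable_def intro: has_field_derivative_at_within)
  qed
  then have G: "g has_fps_expansion fps_expansion g 0"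
    by (intro has_fps_expansion_fps_expansion[of "ball 0 1"]) auto
  have \<phi>: "l (F (\<zeta> *\<^sub>C u)) = \<zeta> * g \<zeta>" for \<zeta>
    by (simp add: F_def g_def u_def[symmetric] bounded_clinear_functional_scaleC[OF l'(1)] lu)
  have "(\<lambda>\<zeta>. l (F (\<zeta> *\<^sub>C u))) has_fps_expansion fps_X * fps_expansion g 0"
    unfolding \<phi> by (intro fps_expansion_intros G)
  then have coeff: "(deriv ^^ n) (\<lambda>\<zeta>. l (F (\<zeta> *\<^sub>C u))) 0 / fact n = fps_nth (fps_X * fps_expansion g 0) n" for n
    by (metis fps_nth_fps_expansion)
  have "l (D3 F 0 z z z) = of_real (norm z) ^ 3 * l (D3 F 0 u u u)"
    using D3_scaleR[of F 0 "norm z" u] u(2) by (simp add: lR)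
  then have "l (D3 F 0 z z z) / of_real (fact 3 * norm z ^ 3) = l (D3 F 0 u u u) / fact 3"
    using z by simp
  also have "\<dots> = fps_nth (fps_expansion g 0) 2"
    unfolding D3_D5_along_line(1)[OF F u(1) l'(1)] coeff by simp
  finally show "l (D3 F 0 z z z) / of_real (fact 3 * norm z ^ 3) = fps_nth (fps_expansion g 0) 2" .
  have "l (D5 F 0 z z z z z) = of_real (norm z) ^ 5 * l (D5 F 0 u u u u u)"
    using D5_scaleR[of F 0 "norm z" u] u(2) by (simp add: lR)
  then have "l (D5 F 0 z z z z z) / of_real (fact 5 * norm z ^ 5) = l (D5 F 0 u u u u u) / fact 5"
    using z by simp
  also have "\<dots> = fps_nth (fps_expansion g 0) 4"
    unfolding D3_D5_along_line(2)[OF F u(1) l'(1)] coeff by simp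
  finally show "l (D5 F 0 z z z z z) / of_real (fact 5 * norm z ^ 5) = fps_nth (fps_expansion g 0) 4" .
qed

text \<open>Since \<open>DF(w) w = (f(w) + Df(w) w) w\<close>, the vector \<open>DF(w)\<^sup>-\<^sup>1 F(w)\<close> is the multiple of \<open>w\<close> with factor
  \<open>f(w) / (f(w) + Df(w) w)\<close>. On a line this is the reciprocal of \<open>1 + \<zeta> g' / g\<close>, so that the geometric
  condition on \<open>F\<close> becomes starlikeness of \<open>\<zeta> g(\<zeta>)\<close>.\<close>

lemma zalcman_for_starlike_mappings:
  fixes f :: "'a::complex_banach \<Rightarrow> complex"
  assumes f: "f frechet_holomorphic_on ball 0 1" and f0: "f 0 = 1"
    and star: "(\<lambda>z. f z *\<^sub>C z) \<in> starlike_mappings"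
    and z: "z \<noteq> 0" and l: "l \<in> support_functionals z"
  shows "cmod ((l (D3 (\<lambda>z. f z *\<^sub>C z) 0 z z z) / of_real (fact 3 * norm z ^ 3))\<^sup>2
              - l (D5 (\<lambda>z. f z *\<^sub>C z) 0 z z z z z) / of_real (fact 5 * norm z ^ 5)) \<le> 4"
proof -
  define F where "F = (\<lambda>z. f z *\<^sub>C z)"
  define u where "u = (1 / norm z) *\<^sub>R z"
  define g where "g \<zeta> = f (\<zeta> *\<^sub>C u)" for \<zeta>
  have u: "norm u = 1" using z by (simp add: u_def)
  have l': "bounded_clinear l" "bounded_linear l" "l z = norm z" "onorm l = 1"
    using l by (simp_all add: support_functionals_def bounded_clinear_def)
  have "l u = 1"
    using l'(2,3) z by (simp add: u_def linear_scale bounded_linear.linear scaleR_conv_of_real)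
  then have lu: "l \<in> support_functionals u"
    using l' u by (simp add: support_functionals_def)
  have id: "bounded_clinear (\<lambda>c::complex. c)"
    by (simp add: bounded_clinear_def bounded_linear_ident)
  have g': "(g has_field_derivative blinfun_apply (fderiv f (\<zeta> *\<^sub>C u)) u) (at \<zeta>)"
    if "\<zeta> \<in> ball 0 1" for \<zeta>
    unfolding g_def using deriv_along_line[OF f u id that] .
  have hol: "g holomorphic_on ball 0 1"
    using g' by (intro holomorphic_onI)
      (auto simp: field_differentiable_def intro: has_field_derivative_at_within)
  have key: "g \<zeta> \<noteq> 0 \<and> Re (1 + \<zeta> * deriv g \<zeta> / g \<zeta>) > 0" if \<zeta>: "\<zeta> \<in> ball 0 1" for \<zeta>
  proof (cases "\<zeta> = 0")
    case True
    then show ?thesis by (simp add: g_def f0)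
  next
    case False
    define w where "w = \<zeta> *\<^sub>C u"
    have w: "w \<in> ball 0 1 - {0}"
      using \<zeta> False u by (auto simp: w_def norm_scaleC simp flip: norm_eq_zero[where 'a = 'a])
    define m where "m = f w + blinfun_apply (fderiv f w) w"
    have m: "m = g \<zeta> + \<zeta> * deriv g \<zeta>"
      using frechet_holomorphic_onD(2)[OF f open_ball, of w \<zeta> u] w DERIV_imp_deriv[OF g'[OF \<zeta>]]
      by (simp add: m_def g_def w_def scaleC_complex_def)
    have bij: "bij (blinfun_apply (fderiv F w))"
      using star w by (auto simp: starlike_mappings_def locally_biholomorphic_on_def F_def)
    have DF: "blinfun_apply (fderiv F w) h = f w *\<^sub>C h + blinfun_apply (fderiv f w) h *\<^sub>C w" for h
      unfolding F_def using w by (intro scaled_identity_derivative(2)[OF f open_ball]) auto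
    have DFw: "blinfun_apply (fderiv F w) (c *\<^sub>C w) = (c * m) *\<^sub>C w" for c
      unfolding DF m_def using frechet_holomorphic_onD(2)[OF f open_ball, of w c w] w
      by (simp add: scaleC_scaleC scaleC_complex_def algebra_simps flip: scaleC_add_left)
    have m0: "m \<noteq> 0"
    proof
      assume "m = 0"
      then have "blinfun_apply (fderiv F w) w = blinfun_apply (fderiv F w) 0"
        using DFw[of 1] by simp
      then have "w = 0"
        by (rule injD[OF bij_is_inj[OF bij]])
      then show False using w by simp
    qed
    have "blinfun_apply (fderiv F w) ((f w / m) *\<^sub>C w) = F w"
      unfolding DFw using m0 by (simp add: F_def)
    then have inv: "inv (blinfun_apply (fderiv F w)) (F w) = (f w / m) *\<^sub>C w"
      using bij by (metis bij_is_inj inv_f_f)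
    have rot: "(\<lambda>x. cnj \<zeta> / cmod \<zeta> * l x) \<in> support_functionals w"
      unfolding w_def by (rule support_functionals_rotate[OF lu u False])
    then have rot_w: "bounded_clinear (\<lambda>x. cnj \<zeta> / cmod \<zeta> * l x)" "cnj \<zeta> / cmod \<zeta> * l w = norm w"
      by (simp_all add: support_functionals_def)
    have "\<forall>z\<in>ball 0 1 - {0}. \<forall>l\<in>support_functionals z. 0 < Re (l (inv (blinfun_apply (fderiv F z)) (F z)))"
      using star[folded F_def] unfolding starlike_mappings_def by blast
    from this[rule_format, OF w rot]
    have "0 < Re (cnj \<zeta> / cmod \<zeta> * l (inv (blinfun_apply (fderiv F w)) (F w)))" .
    also have "cnj \<zeta> / cmod \<zeta> * l (inv (blinfun_apply (fderiv F w)) (F w)) = (f w / m) * norm w"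
      unfolding inv rot_w(2)[symmetric] by (rule bounded_clinear_functional_scaleC[OF rot_w(1)])
    finally have "0 < Re (f w / m) * norm w"
      by (simp del: times_divide_eq_left)
    then have pos: "0 < Re (f w / m)"
      using w by (simp add: zero_less_mult_iff)
    then have fw: "f w \<noteq> 0" by auto
    have "Re (inverse (f w / m)) = Re (f w / m) / (cmod (f w / m))\<^sup>2"
      by (simp only: cmod_power2 inverse_complex.sel)
    also have "\<dots> > 0"
      using pos fw m0 by simp
    finally have "Re (m / f w) > 0" by simp
    moreover have "m / f w = 1 + \<zeta> * deriv g \<zeta> / g \<zeta>"
      using fw unfolding m by (simp add: g_def w_def add_divide_distrib)
    ultimately show ?thesis
      using fw by (simp add: g_def w_def)
  qed
  have "cmod ((fps_nth (fps_expansion g 0) 2)\<^sup>2 - fps_nth (fps_expansion g 0) 4) \<le> 4"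
    using key by (intro starlike_zalcman hol) (auto simp: g_def f0)
  then show ?thesis
    using slice_coefficients[OF f z l] unfolding g_def[abs_def] u_def by simp
qed

section \<open>The Koebe mapping\<close>

text \<open>The derivative is a multiple of the identity plus an operator of rank one, so its inverse \<open>J z\<close> can
  be written down. The starlikeness quotient is the Cayley transform \<open>(1 - l z) / (1 + l z)\<close>, which
  has positive real part because \<open>\<bar>l z\<bar> < 1\<close>.\<close>

lemma koebe_mapping:
  fixes l :: "'a::complex_normed_vector \<Rightarrow> complex"
  assumes l: "bounded_clinear l" and le: "\<And>x. cmod (l x) \<le> norm x"
  defines "f \<equiv> \<lambda>z. 1 / (1 - l z)\<^sup>2"
  shows "f frechet_holomorphic_on ball 0 1" and "(\<lambda>z. f z *\<^sub>C z) \<in> starlike_mappings"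
proof -
  have bl: "bounded_linear l" and hom: "l (c *\<^sub>C x) = c * l x" for c x
    using l bounded_clinear_functional_scaleC[OF l] by (auto simp: bounded_clinear_def)
  have l_lt: "cmod (l z) < 1" if "z \<in> ball 0 1" for z
    using le[of z] that by simp
  have ne: "1 - l z \<noteq> 0" "1 + l z \<noteq> 0" if "z \<in> ball 0 1" for z
  proof -
    have "l z \<noteq> 1" "l z \<noteq> - 1"
      using l_lt[OF that] by auto
    then show "1 - l z \<noteq> 0" "1 + l z \<noteq> 0"
      by (auto simp: add_eq_0_iff)
  qed
  have df: "(f has_derivative (\<lambda>h. 2 / (1 - l z) ^ 3 * l h)) (at z)" if z: "z \<in> ball 0 1" for z
  proof -
    have "((\<lambda>\<zeta>. 1 / (1 - \<zeta>)\<^sup>2) has_field_derivative 2 / (1 - l z) ^ 3) (at (l z))"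
      using ne[OF z] by (auto intro!: derivative_eq_intros simp: divide_simps power2_eq_square power3_eq_cube)
    then have "((\<lambda>\<zeta>. 1 / (1 - \<zeta>)\<^sup>2) has_derivative (\<lambda>h. 2 / (1 - l z) ^ 3 * h)) (at (l z))"
      unfolding has_field_derivative_def .
    from has_derivative_compose[OF bounded_linear_imp_has_derivative[OF bl] this]
    show ?thesis unfolding f_def .
  qed
  show f: "f frechet_holomorphic_on ball 0 1"
    using df by (rule frechet_holomorphic_onI) (simp_all add: hom scaleC_complex_def)
  define F where "F = (\<lambda>z. f z *\<^sub>C z)"
  have Df: "blinfun_apply (fderiv f z) h = 2 / (1 - l z) ^ 3 * l h" if z: "z \<in> ball 0 1" for z h
    using has_derivative_unique[OF frechet_holomorphic_onD(1)[OF f open_ball z] df[OF z]] by metis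
  have DF: "blinfun_apply (fderiv F z) h = f z *\<^sub>C h + (2 / (1 - l z) ^ 3 * l h) *\<^sub>C z"
    if z: "z \<in> ball 0 1" for z h
    unfolding F_def scaled_identity_derivative(2)[OF f open_ball z] Df[OF z] ..
  have lin: "l (x + y) = l x + l y" "l (x - y) = l x - l y" for x y
    using bl by (auto simp: linear_add linear_diff bounded_linear.linear)
  define J where "J z y = (1 - l z)\<^sup>2 *\<^sub>C (y - (2 * l y / (1 + l z)) *\<^sub>C z)" for z y
  have DF_J: "blinfun_apply (fderiv F z) (J z y) = y" if z: "z \<in> ball 0 1" for z y
  proof -
    have lJ: "l (J z y) = (1 - l z) ^ 3 * l y / (1 + l z)"
      using ne[OF z] by (simp add: J_def hom lin field_simps power2_eq_square power3_eq_cube)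
    have "f z *\<^sub>C J z y = y - (2 * l y / (1 + l z)) *\<^sub>C z"
      using ne[OF z] by (simp add: J_def f_def scaleC_scaleC)
    moreover have "2 / (1 - l z) ^ 3 * l (J z y) = 2 * l y / (1 + l z)"
      unfolding lJ using ne[OF z] by simp
    ultimately show ?thesis
      unfolding DF[OF z] by simp
  qed
  have J_DF: "J z (blinfun_apply (fderiv F z) h) = h" if z: "z \<in> ball 0 1" for z h
  proof -
    have lDF: "l (blinfun_apply (fderiv F z) h) = (1 + l z) / (1 - l z) ^ 3 * l h"
    proof -
      define a where "a = 1 - l z"
      have a: "a \<noteq> 0" "l z = 1 - a"
        using ne[OF z] by (simp_all add: a_def)
      show ?thesis
        unfolding DF[OF z] lin hom f_def a(2) using a(1)
        by (simp add: field_simps power2_eq_square power3_eq_cube)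
    qed
    then have "(2 * l (blinfun_apply (fderiv F z) h) / (1 + l z)) *\<^sub>C z = (2 / (1 - l z) ^ 3 * l h) *\<^sub>C z"
      using ne[OF z] by simp
    then have "J z (blinfun_apply (fderiv F z) h) = (1 - l z)\<^sup>2 *\<^sub>C f z *\<^sub>C h"
      unfolding J_def by (simp add: DF[OF z])
    then show ?thesis
      using ne[OF z] by (simp add: f_def scaleC_scaleC)
  qed
  have bij: "bij (blinfun_apply (fderiv F z))" and inv: "inv (blinfun_apply (fderiv F z)) = J z"
    if z: "z \<in> ball 0 1" for z
  proof -
    have "blinfun_apply (fderiv F z) \<circ> J z = id" "J z \<circ> blinfun_apply (fderiv F z) = id"
      using J_DF[OF z] DF_J[OF z] by (simp_all add: fun_eq_iff)
    then show "bij (blinfun_apply (fderiv F z))" "inv (blinfun_apply (fderiv F z)) = J z"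
      by (blast intro: o_bij, blast intro: inv_unique_comp)
  qed
  have J: "bounded_clinear (J z)" for z
  proof (rule bounded_clinearI)
    have "J z = (\<lambda>y. (1 - l z)\<^sup>2 *\<^sub>C (y - (2 / (1 + l z) * l y) *\<^sub>C z))"
      by (simp add: J_def fun_eq_iff)
    then show "bounded_linear (J z)"
      by (simp only:, intro bounded_linear_compose[OF scaleC.bounded_linear_right] bounded_linear_sub
          bounded_linear_ident bounded_linear_compose[OF scaleC.bounded_linear_left]
          bounded_linear_compose[OF bounded_linear_mult_right bl])
    show "J z (c *\<^sub>C y) = c *\<^sub>C J z y" for c y
      by (simp add: J_def hom scaleC.diff_right scaleC_scaleC mult_ac)
  qed
  have "F frechet_holomorphic_on ball 0 1"
    unfolding F_def using f by (rule frechet_holomorphic_on_scaled_identity) simp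
  then have "F locally_biholomorphic_on ball 0 1"
    unfolding locally_biholomorphic_on_def using bij inv J by simp
  moreover have "normalized F"
    unfolding normalized_def
    using linear_0[OF bounded_linear.linear[OF bl]]
    by (auto simp: F_def f_def DF[unfolded F_def f_def] intro!: blinfun_eqI)
  moreover have "Re (m (inv (blinfun_apply (fderiv F z)) (F z))) > 0"
    if z: "z \<in> ball 0 1 - {0}" and m: "m \<in> support_functionals z" for z m
  proof -
    have zb: "z \<in> ball 0 1" using z by simp
    have m': "m (c *\<^sub>C z) = c * norm z" for c
      using m bounded_clinear_functional_scaleC[of m c z] by (simp add: support_functionals_def)
    define q where "q = (1 - l z) / (1 + l z)"
    have "J z (F z) = ((1 - l z)\<^sup>2 * (f z - 2 * (f z * l z) / (1 + l z))) *\<^sub>C z"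
      by (simp add: J_def F_def hom scaleC_scaleC flip: scaleC.diff_left)
    also have "(1 - l z)\<^sup>2 * (f z - 2 * (f z * l z) / (1 + l z)) = q"
    proof -
      define a where "a = 1 - l z"
      have a: "a \<noteq> 0" "2 - a \<noteq> 0" "l z = 1 - a"
        using ne[OF zb] by (simp_all add: a_def)
      show ?thesis
        unfolding f_def q_def a(3) using a(1,2) by (simp add: field_simps)
    qed
    finally have "m (inv (blinfun_apply (fderiv F z)) (F z)) = q * norm z"
      unfolding inv[OF zb] by (simp add: m')
    moreover have "Re q > 0"
    proof -
      have "Re q = (1 - (cmod (l z))\<^sup>2) / (cmod (1 + l z))\<^sup>2"
        unfolding q_def Re_divide cmod_power2 by (simp add: power2_eq_square algebra_simps)
      also have "\<dots> > 0"
        using l_lt[OF zb] ne[OF zb] by (intro divide_pos_pos) (auto simp: power_less_one_iff abs_square_less_1)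
      finally show ?thesis .
    qed
    ultimately show ?thesis using z by simp
  qed
  ultimately show "(\<lambda>z. f z *\<^sub>C z) \<in> starlike_mappings"
    unfolding starlike_mappings_def F_def by blast
qed

lemma koebe_coefficients:
  defines "k \<equiv> \<lambda>\<zeta>::complex. 1 / (1 - \<zeta>)\<^sup>2"
  shows "fps_nth (fps_expansion k 0) 2 = 3" and "fps_nth (fps_expansion k 0) 4 = 5"
proof -
  define G where "G = fps_expansion k 0"
  have "k holomorphic_on ball 0 1"
    unfolding k_def by (intro holomorphic_intros) auto
  then have G: "k has_fps_expansion G"
    unfolding G_def by (intro has_fps_expansion_fps_expansion[of "ball 0 1"]) auto
  have "(\<lambda>\<zeta>. (1 - \<zeta>) * ((1 - \<zeta>) * k \<zeta>)) has_fps_expansion (1 - fps_X) * ((1 - fps_X) * G)"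
    by (intro fps_expansion_intros G)
  moreover have ev: "\<forall>\<^sub>F \<zeta> in nhds 0. (1 - \<zeta>) * ((1 - \<zeta>) * k \<zeta>) = 1"
  proof (rule eventually_nhds_in_open[of "ball 0 1" 0, THEN eventually_mono])
    fix \<zeta> :: complex assume "\<zeta> \<in> ball 0 1"
    then have "1 - \<zeta> \<noteq> 0" by auto
    then show "(1 - \<zeta>) * ((1 - \<zeta>) * k \<zeta>) = 1"
      by (simp add: k_def power2_eq_square)
  qed auto
  ultimately have "(\<lambda>\<zeta>. 1) has_fps_expansion (1 - fps_X) * ((1 - fps_X) * G)"
    using has_fps_expansion_cong[OF ev refl] by blast
  then have eq: "(1 - fps_X) * ((1 - fps_X) * G) = 1"
    using has_fps_expansion_1 by (rule fps_expansion_unique_complex)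
  have step: "fps_nth ((1 - fps_X) * A) (Suc n) = fps_nth A (Suc n) - fps_nth A n"
    "fps_nth ((1 - fps_X) * A) 0 = fps_nth A 0" for A :: "complex fps" and n
    by (simp_all add: left_diff_distrib)
  have H: "fps_nth ((1 - fps_X) * G) n = 1" for n
  proof (induction n)
    case 0
    show ?case using step(2)[of "(1 - fps_X) * G"] unfolding eq by simp
  next
    case (Suc n)
    then show ?case using step(1)[of "(1 - fps_X) * G" n] unfolding eq by simp
  qed
  have "fps_nth G n = of_nat (Suc n)" for n
  proof (induction n)
    case 0
    show ?case using H[of 0] by (simp add: step)
  next
    case (Suc n)
    then show ?case using H[of "Suc n"] by (simp add: step diff_eq_eq add_ac)
  qed
  then show "fps_nth (fps_expansion k 0) 2 = 3" "fps_nth (fps_expansion k 0) 4 = 5"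
    by (simp_all add: G_def)
qed

section \<open>The sharp bound\<close>

theorem theorem2:
  assumes "\<exists>x::'a::complex_banach. x \<noteq> 0"
  shows "(\<forall>f :: 'a \<Rightarrow> complex.
      f frechet_holomorphic_on (ball 0 1) \<and> f 0 = 1 \<and> (\<lambda>z. f z *\<^sub>C z) \<in> starlike_mappings \<longrightarrow>
      (\<forall>z. z \<noteq> 0 \<longrightarrow> (\<forall>l \<in> support_functionals z.
        cmod ((l (D3 (\<lambda>z. f z *\<^sub>C z) 0 z z z) / of_real (fact 3 * norm z ^ 3))\<^sup>2
              - l (D5 (\<lambda>z. f z *\<^sub>C z) 0 z z z z z) / of_real (fact 5 * norm z ^ 5)) \<le> 4)))
    \<and> (\<exists>f :: 'a \<Rightarrow> complex.
      f frechet_holomorphic_on (ball 0 1) \<and> f 0 = 1 \<and> (\<lambda>z. f z *\<^sub>C z) \<in> starlike_mappings \<and>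
      (\<exists>z. z \<noteq> 0 \<and> (\<exists>l \<in> support_functionals z.
        cmod ((l (D3 (\<lambda>z. f z *\<^sub>C z) 0 z z z) / of_real (fact 3 * norm z ^ 3))\<^sup>2
              - l (D5 (\<lambda>z. f z *\<^sub>C z) 0 z z z z z) / of_real (fact 5 * norm z ^ 5)) = 4)))"
proof (rule conjI)
  \<comment> \<open>Equality holds for the Koebe mapping of a norming functional, where the difference is \<open>3\<^sup>2 - 5\<close>.\<close>
  obtain z :: 'a where z: "z \<noteq> 0"
    using assms by blast
  obtain l where l: "bounded_clinear l" "l z = of_real (norm z)" and le: "\<And>y. cmod (l y) \<le> norm y"
    by (rule norming_functional_exists[of z]) blast
  have bl: "bounded_linear l"
    using l(1) by (simp add: bounded_clinear_def)
  have "onorm l = 1"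
  proof (rule antisym)
    show "onorm l \<le> 1"
      using le by (intro onorm_bound) auto
    have "norm z \<le> onorm l * norm z"
      using onorm[OF bl, of z] l(2) by simp
    then show "1 \<le> onorm l"
      using z by simp
  qed
  then have supp: "l \<in> support_functionals z"
    using l by (simp add: support_functionals_def)
  define f where "f x = 1 / (1 - l x)\<^sup>2" for x
  have f: "f frechet_holomorphic_on ball 0 1" "(\<lambda>z. f z *\<^sub>C z) \<in> starlike_mappings"
    unfolding f_def using koebe_mapping[OF l(1) le] by simp_all
  have "f 0 = 1"
    using linear_0[OF bounded_linear.linear[OF bl]] by (simp add: f_def)
  have "l ((1 / norm z) *\<^sub>R z) = 1"
    using l(2) z bl by (simp add: linear_scale bounded_linear.linear scaleR_conv_of_real)
  then have "(\<lambda>\<zeta>. f (\<zeta> *\<^sub>C (1 / norm z) *\<^sub>R z)) = (\<lambda>\<zeta>. 1 / (1 - \<zeta>)\<^sup>2)"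
    by (simp add: f_def bounded_clinear_functional_scaleC[OF l(1)])
  then have "cmod ((l (D3 (\<lambda>z. f z *\<^sub>C z) 0 z z z) / of_real (fact 3 * norm z ^ 3))\<^sup>2
      - l (D5 (\<lambda>z. f z *\<^sub>C z) 0 z z z z z) / of_real (fact 5 * norm z ^ 5)) = cmod (3\<^sup>2 - 5)"
    unfolding slice_coefficients[OF f(1) z supp] by (simp only: koebe_coefficients)
  also have "\<dots> = 4" by simp
  finally show "\<exists>f :: 'a \<Rightarrow> complex.
      f frechet_holomorphic_on (ball 0 1) \<and> f 0 = 1 \<and> (\<lambda>z. f z *\<^sub>C z) \<in> starlike_mappings \<and>
      (\<exists>z. z \<noteq> 0 \<and> (\<exists>l \<in> support_functionals z.
        cmod ((l (D3 (\<lambda>z. f z *\<^sub>C z) 0 z z z) / of_real (fact 3 * norm z ^ 3))\<^sup>2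
              - l (D5 (\<lambda>z. f z *\<^sub>C z) 0 z z z z z) / of_real (fact 5 * norm z ^ 5)) = 4))"
    using f \<open>f 0 = 1\<close> z supp by blast
qed (use zalcman_for_starlike_mappings in blast)

end
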